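(* Let $\mathbbm{k}$ be a field of characteristic $0$, let $N \geqslant 2$ and $s \geqslant 4^N$. Let $I \subseteq \mathbbm{k}[x_0,\dots,x_N]$ be the defining ideal of a general set of $s$ points in $\mathbb{P}^N_{\mathbbm{k}}$. Then for every $m \in \mathbb{N}$, $$\frac{\alpha(I^{(m)})}{m} \geqslant \frac{\alpha(I)+N-1}{N}.$$
   Context: For a homogeneous ideal $J$, $\alpha(J)$ denotes the least degree of a nonzero homogeneous element of $J$. For the ideal $I$ of a finite set of points with point ideals $\mathfrak{p}_1,\dots,\mathfrak{p}_s$, $I^{(m)} = \mathfrak{p}_1^m \cap \dots \cap \mathfrak{p}_s^m$. A property holds for a general set of $s$ points in $\mathbb{P}^N_{\mathbbm{k}}$ if there is a nonempty Zariski open subset $U$ of the parameter space of $s$ points (e.g. of $\mathbb{A}^{s(N+1)}_{\mathbbm{k}}$, with $\mathbf{a}=(a_{ij})$ giving the points $[a_{i0}:\dots:a_{iN}]$) such that the property holds for every set of points corresponding to a point of $U$. *)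

theory Defs
  imports Complex_Main "HOL-Library.Poly_Mapping"
begin

type_synonym ('v, 'a) mpoly = "('v \<Rightarrow>\<^sub>0 nat) \<Rightarrow>\<^sub>0 'a"

definition mpoly_vars :: "('v, 'a::zero) mpoly \<Rightarrow> 'v set" where
  "mpoly_vars p = (\<Union>mon \<in> Poly_Mapping.keys p. Poly_Mapping.keys mon)"

definition mpoly_eval :: "('v \<Rightarrow> 'a::comm_semiring_1) \<Rightarrow> ('v, 'a) mpoly \<Rightarrow> 'a" where
  "mpoly_eval a p = (\<Sum>mon \<in> Poly_Mapping.keys p.
      Poly_Mapping.lookup p mon * (\<Prod>i \<in> Poly_Mapping.keys mon. a i ^ Poly_Mapping.lookup mon i))"

definition mon_deg :: "('v \<Rightarrow>\<^sub>0 nat) \<Rightarrow> nat" where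
  "mon_deg mon = (\<Sum>i \<in> Poly_Mapping.keys mon. Poly_Mapping.lookup mon i)"

definition homogeneous_of_deg :: "nat \<Rightarrow> ('v, 'a::zero) mpoly \<Rightarrow> bool" where
  "homogeneous_of_deg d p \<longleftrightarrow> (\<forall>mon \<in> Poly_Mapping.keys p. mon_deg mon = d)"

definition polyring :: "nat \<Rightarrow> (nat, 'a::zero) mpoly set" where
  "polyring N = {p. mpoly_vars p \<subseteq> {0..N}}"

definition ideal_gen :: "'b::comm_ring_1 set \<Rightarrow> 'b set \<Rightarrow> 'b set" where
  "ideal_gen R S = {\<Sum>i<n. c i * g i | (n::nat) c g. \<forall>i<n. c i \<in> R \<and> g i \<in> S}"

fun ideal_pow :: "'b::comm_ring_1 set \<Rightarrow> 'b set \<Rightarrow> nat \<Rightarrow> 'b set" where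
  "ideal_pow R J 0 = R"
| "ideal_pow R J (Suc m) = ideal_gen R {f * g | f g. f \<in> J \<and> g \<in> ideal_pow R J m}"

text \<open>The (homogeneous) ideal of the projective point [a_0:...:a_N] in k[x_0..x_N]:
  polynomials vanishing on the whole line through the representative a.\<close>
definition point_ideal :: "nat \<Rightarrow> (nat \<Rightarrow> 'a::field) \<Rightarrow> (nat, 'a) mpoly set" where
  "point_ideal N a = {f \<in> polyring N. \<forall>c. mpoly_eval (\<lambda>j. c * a j) f = 0}"

definition symbolic_power :: "nat \<Rightarrow> nat \<Rightarrow> (nat \<Rightarrow> nat \<Rightarrow> 'a::field) \<Rightarrow> nat \<Rightarrow> (nat, 'a) mpoly set" where
  "symbolic_power N s P m = (\<Inter>i \<in> {..<s}. ideal_pow (polyring N) (point_ideal N (P i)) m)"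

definition points_ideal :: "nat \<Rightarrow> nat \<Rightarrow> (nat \<Rightarrow> nat \<Rightarrow> 'a::field) \<Rightarrow> (nat, 'a) mpoly set" where
  "points_ideal N s P = (\<Inter>i \<in> {..<s}. point_ideal N (P i))"

definition alpha :: "('v, 'a::zero) mpoly set \<Rightarrow> nat" where
  "alpha J = (LEAST d. \<exists>f \<in> J. f \<noteq> 0 \<and> homogeneous_of_deg d f)"

text \<open>Zariski open subsets of affine space with coordinates indexed by the set V
  (points are functions 'v \<Rightarrow> 'a; only coordinates in V matter).\<close>
definition zariski_open :: "'v set \<Rightarrow> ('v \<Rightarrow> 'a::comm_ring_1) set \<Rightarrow> bool" where
  "zariski_open V U \<longleftrightarrow> (\<exists>S. (\<forall>F \<in> S. mpoly_vars F \<subseteq> V) \<and>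
       U = {a. \<exists>F \<in> S. mpoly_eval a F \<noteq> 0})"

text \<open>The rows a(i,0..N), i < s, give s distinct points of P^N.\<close>
definition valid_points :: "nat \<Rightarrow> nat \<Rightarrow> (nat \<times> nat \<Rightarrow> 'a::field) \<Rightarrow> bool" where
  "valid_points N s a \<longleftrightarrow>
     (\<forall>i<s. \<exists>j\<le>N. a (i, j) \<noteq> 0) \<and>
     (\<forall>i<s. \<forall>i'<s. i \<noteq> i' \<longrightarrow> \<not> (\<exists>c. \<forall>j\<le>N. a (i, j) = c * a (i', j)))"

end

theory Submission
  imports Defs "Jordan_Normal_Form.Determinant"
begin

text \<open>
  Choose \<open>k \<ge> 4\<close> with \<open>k ^ N \<le> s < (k + 1) ^ N\<close>. Then \<open>s < (N * k) choose N\<close>, so some form of degree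
  \<open>N * (k - 1)\<close> passes through the points, and it suffices to show that a form of multiplicity \<open>m\<close> at
  the first \<open>k ^ N\<close> points has degree at least \<open>(k - 1 / N) * m\<close>. The points of a \<open>k \<times> \<dots> \<times> k\<close> grid
  are a complete intersection, whence forms of degree \<open>k * c + N * (k - 1)\<close> separate jets of order \<open>c\<close>
  at them. For a single \<open>c\<close> this is an open condition on the points, and it propagates to forms of
  degree \<open>r * (k * c + N * (k - 1))\<close> and jets of order \<open>r * c\<close>, for all \<open>r\<close>, by multiplying forms. Thus
  one open set serves all \<open>m\<close>, and letting \<open>r\<close> tend to infinity in a dimension count yields the
  degree bound once \<open>c\<close> is large compared to \<open>N * (k - 1)\<close>. The slack \<open>1 / N\<close> pays for \<open>c\<close> being finite.
\<close>

section \<open>Evaluation homomorphisms\<close>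

lemma mon_deg_superset:
  assumes "finite S" "Poly_Mapping.keys \<mu> \<subseteq> S"
  shows "mon_deg \<mu> = (\<Sum>i\<in>S. Poly_Mapping.lookup \<mu> i)"
  unfolding mon_deg_def using assms by (intro sum.mono_neutral_left) (auto simp: in_keys_iff)

lemma mon_deg_add: "mon_deg (m + m') = mon_deg m + mon_deg m'"
proof -
  let ?S = "Poly_Mapping.keys m \<union> Poly_Mapping.keys m'"
  have "mon_deg (m + m') = (\<Sum>i\<in>?S. Poly_Mapping.lookup (m + m') i)"
    using Poly_Mapping.keys_add[of m m'] by (intro mon_deg_superset) auto
  also have "\<dots> = mon_deg m + mon_deg m'"
    by (simp add: lookup_add sum.distrib mon_deg_superset[of ?S])
  finally show ?thesis .
qed

lemma mon_deg_zero [simp]: "mon_deg 0 = 0"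
  by (simp add: mon_deg_def)

lemma mon_deg_single [simp]: "mon_deg (Poly_Mapping.single i e) = e"
  by (simp add: mon_deg_def)

lemma keys_add_nat:
  "Poly_Mapping.keys (m + m' :: 'v \<Rightarrow>\<^sub>0 nat) = Poly_Mapping.keys m \<union> Poly_Mapping.keys m'"
  by (auto simp: in_keys_iff lookup_add)

text \<open>The target is an arbitrary commutative semiring, so that one notion serves both scalar
  values and substitution of polynomials.\<close>

definition mon_val :: "('v \<Rightarrow> 'b::comm_semiring_1) \<Rightarrow> ('v \<Rightarrow>\<^sub>0 nat) \<Rightarrow> 'b" where
  "mon_val x \<mu> = (\<Prod>i\<in>Poly_Mapping.keys \<mu>. x i ^ Poly_Mapping.lookup \<mu> i)"

lemma mon_val_superset:
  assumes "finite S" "Poly_Mapping.keys \<mu> \<subseteq> S"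
  shows "mon_val x \<mu> = (\<Prod>i\<in>S. x i ^ Poly_Mapping.lookup \<mu> i)"
  unfolding mon_val_def using assms by (intro prod.mono_neutral_left) (auto simp: in_keys_iff)

lemma mon_val_add: "mon_val x (m + m') = mon_val x m * mon_val x m'"
proof -
  let ?S = "Poly_Mapping.keys m \<union> Poly_Mapping.keys m'"
  have "mon_val x (m + m') = (\<Prod>i\<in>?S. x i ^ Poly_Mapping.lookup (m + m') i)"
    using Poly_Mapping.keys_add[of m m'] by (intro mon_val_superset) auto
  also have "\<dots> = mon_val x m * mon_val x m'"
    by (simp add: lookup_add power_add prod.distrib mon_val_superset[of ?S])
  finally show ?thesis .
qed

lemma mon_val_zero [simp]: "mon_val x 0 = 1"
  by (simp add: mon_val_def)

lemma mon_val_single [simp]: "mon_val x (Poly_Mapping.single i e) = x i ^ e"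
  by (cases "e = 0") (simp_all add: mon_val_def)

lemma mon_val_scale:
  fixes x :: "'v \<Rightarrow> 'b::comm_semiring_1"
  shows "mon_val (\<lambda>j. c * x j) m = c ^ mon_deg m * mon_val x m"
  by (simp add: mon_val_def mon_deg_def power_mult_distrib prod.distrib power_sum)

lemma mpoly_induct [case_names single add]:
  assumes "\<And>m c. P (Poly_Mapping.single m c)" and "\<And>p q. P p \<Longrightarrow> P q \<Longrightarrow> P (p + q)"
  shows "P (p :: 'm \<Rightarrow>\<^sub>0 'a::comm_monoid_add)"
proof -
  have "P (\<Sum>m\<in>S. Poly_Mapping.single m (Poly_Mapping.lookup p m))" if "finite S" for S
    using that
  proof induction
    case empty
    then show ?case using assms(1)[of undefined 0] by simp
  qed (auto intro: assms)
  moreover have "(\<Sum>m\<in>Poly_Mapping.keys p. Poly_Mapping.single m (Poly_Mapping.lookup p m)) = p"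
    by (intro poly_mapping_eqI)
      (auto simp: lookup_sum lookup_single when_def sum.delta in_keys_iff)
  ultimately show ?thesis
    using finite_keys[of p] by metis
qed

text \<open>The universal property of the polynomial ring: \<open>ext\<close> is the ring
  homomorphism that acts as \<open>\<phi>\<close> on coefficients and sends the variable
  \<open>i\<close> to \<open>x i\<close>. It is instantiated by evaluation, with
  \<open>\<phi>\<close> the identity, and by Taylor expansion, with \<open>\<phi>\<close> equal to
  \<open>cst\<close>.\<close>

locale mpoly_hom =
  fixes \<phi> :: "'a::comm_ring_1 \<Rightarrow> 'b::comm_ring_1" and x :: "'v \<Rightarrow> 'b"
  assumes coeff_add: "\<phi> (u + v) = \<phi> u + \<phi> v"
    and coeff_mult: "\<phi> (u * v) = \<phi> u * \<phi> v"
    and coeff_one: "\<phi> 1 = 1"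
begin

lemma coeff_zero: "\<phi> 0 = 0"
  using coeff_add[of 0 0] by simp

definition ext :: "('v, 'a) mpoly \<Rightarrow> 'b" where
  "ext p = (\<Sum>m\<in>Poly_Mapping.keys p. \<phi> (Poly_Mapping.lookup p m) * mon_val x m)"

lemma ext_superset:
  assumes "finite S" "Poly_Mapping.keys p \<subseteq> S"
  shows "ext p = (\<Sum>m\<in>S. \<phi> (Poly_Mapping.lookup p m) * mon_val x m)"
  unfolding ext_def using assms by (intro sum.mono_neutral_left) (auto simp: in_keys_iff coeff_zero)

lemma ext_single: "ext (Poly_Mapping.single m c) = \<phi> c * mon_val x m"
  by (cases "c = 0") (simp_all add: ext_def coeff_zero)

lemma ext_zero [simp]: "ext 0 = 0"
  by (simp add: ext_def)

lemma ext_one [simp]: "ext 1 = 1"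
  using ext_single[of 0 1] by (simp add: coeff_one)

lemma ext_add: "ext (p + q) = ext p + ext q"
proof -
  let ?S = "Poly_Mapping.keys p \<union> Poly_Mapping.keys q"
  have "ext (p + q) = (\<Sum>m\<in>?S. \<phi> (Poly_Mapping.lookup (p + q) m) * mon_val x m)"
    using Poly_Mapping.keys_add[of p q] by (intro ext_superset) auto
  also have "\<dots> = ext p + ext q"
    by (simp add: lookup_add coeff_add distrib_right sum.distrib ext_superset[of ?S])
  finally show ?thesis .
qed

lemma ext_sum: "ext (sum f A) = (\<Sum>i\<in>A. ext (f i))"
  by (induction A rule: infinite_finite_induct) (auto simp: ext_add)

lemma ext_mult: "ext (p * q) = ext p * ext q"
proof (induction p rule: mpoly_induct)
  case (single m c)
  show ?case
    by (induction q rule: mpoly_induct)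
      (simp_all add: mult_single ext_single coeff_mult mon_val_add distrib_left ext_add)
qed (simp add: distrib_right ext_add)

lemma ext_power: "ext (p ^ n) = ext p ^ n"
  by (induction n) (simp_all add: ext_mult)

lemma ext_prod: "ext (prod f A) = (\<Prod>i\<in>A. ext (f i))"
  by (induction A rule: infinite_finite_induct) (auto simp: ext_mult)

end

section \<open>Constants and variables as polynomials\<close>

definition cst :: "'a::zero \<Rightarrow> ('v, 'a) mpoly" where
  "cst c = Poly_Mapping.single 0 c"

definition var :: "'v \<Rightarrow> ('v, 'a::comm_semiring_1) mpoly" where
  "var i = Poly_Mapping.single (Poly_Mapping.single i 1) 1"

lemma cst_add: "cst (u + v) = cst u + cst v" for u v :: "'a::comm_ring_1"
  by (simp add: cst_def single_add)

lemma cst_mult: "cst (u * v) = cst u * cst v" for u v :: "'a::comm_ring_1"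
  by (simp add: cst_def mult_single)

lemma cst_one [simp]: "cst 1 = 1"
  by (simp add: cst_def)

lemma cst_zero [simp]: "cst 0 = 0"
  by (simp add: cst_def)

lemma lookup_cst_mult:
  "Poly_Mapping.lookup (cst c * p) m = c * Poly_Mapping.lookup p m" for c :: "'a::comm_ring_1"
  by (induction p rule: mpoly_induct)
    (auto simp: cst_def mult_single lookup_single when_def distrib_left lookup_add)

lemma single_eq_cst_mult: "Poly_Mapping.single m c = cst c * Poly_Mapping.single m (1::'a::comm_ring_1)"
  by (simp add: cst_def mult_single)

interpretation eval: mpoly_hom "\<lambda>c. c" a
  rewrites "mpoly_hom.ext (\<lambda>c. c) a = mpoly_eval a" for a :: "'v \<Rightarrow> 'a::comm_ring_1"
proof -
  show "mpoly_hom (\<lambda>c::'a. c)" by unfold_locales auto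
  then show "mpoly_hom.ext (\<lambda>c. c) a = mpoly_eval a"
    by (simp add: fun_eq_iff mpoly_hom.ext_def mpoly_eval_def mon_val_def)
qed

section \<open>Forms and order of vanishing\<close>

definition expos :: "nat \<Rightarrow> nat \<Rightarrow> (nat \<Rightarrow>\<^sub>0 nat) set" where
  "expos N D = {\<mu>. Poly_Mapping.keys \<mu> \<subseteq> {0..N} \<and> mon_deg \<mu> = D}"

text \<open>Transports the stars-and-bars count from lists of length \<open>Suc N\<close> with sum
  \<open>D\<close> to monomials of degree \<open>D\<close>.\<close>

lemma bij_betw_expos_lists:
  "bij_betw (\<lambda>\<mu>. map (Poly_Mapping.lookup \<mu>) [0..<Suc N]) (expos N D)
     {l. length l = Suc N \<and> sum_list l = D}"
proof (rule bij_betwI[where g = Poly_Mapping.nth])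
  have sum: "sum_list (map (Poly_Mapping.lookup \<mu>) [0..<Suc N]) = mon_deg \<mu>"
    if "Poly_Mapping.keys \<mu> \<subseteq> {0..N}" for \<mu> :: "nat \<Rightarrow>\<^sub>0 nat"
    using mon_deg_superset[OF _ that]
    by (simp add: interv_sum_list_conv_sum_set_nat atLeastLessThanSuc_atLeastAtMost del: upt_Suc)
  then show "(\<lambda>\<mu>. map (Poly_Mapping.lookup \<mu>) [0..<Suc N]) \<in>
      expos N D \<rightarrow> {l. length l = Suc N \<and> sum_list l = D}"
    by (auto simp: expos_def simp del: upt_Suc)
  show inv2: "map (Poly_Mapping.lookup (Poly_Mapping.nth l)) [0..<Suc N] = l"
    if "l \<in> {l. length l = Suc N \<and> sum_list l = D}" for l
    using that by (intro nth_equalityI) (auto simp: nth_default_nth simp del: upt_Suc)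
  show "Poly_Mapping.nth \<in> {l. length l = Suc N \<and> sum_list l = D} \<rightarrow> expos N D"
  proof
    fix l :: "nat list" assume l: "l \<in> {l. length l = Suc N \<and> sum_list l = D}"
    have k: "Poly_Mapping.keys (Poly_Mapping.nth l) \<subseteq> {0..N}"
      using l by (auto simp: in_keys_iff nth_default_def simp del: keys_nth split: if_splits)
    show "Poly_Mapping.nth l \<in> expos N D"
      using sum[OF k] k inv2[OF l] l by (simp add: expos_def del: upt_Suc)
  qed
  show "Poly_Mapping.nth (map (Poly_Mapping.lookup \<mu>) [0..<Suc N]) = \<mu>" if "\<mu> \<in> expos N D" for \<mu>
  proof (rule poly_mapping_eqI)
    fix i
    show "Poly_Mapping.lookup (Poly_Mapping.nth (map (Poly_Mapping.lookup \<mu>) [0..<Suc N])) i =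
        Poly_Mapping.lookup \<mu> i"
      using that by (cases "i \<le> N") (auto simp: expos_def nth_default_def in_keys_iff simp del: upt_Suc)
  qed
qed

lemma card_expos: "card (expos N D) = (D + N) choose N"
  using bij_betw_same_card[OF bij_betw_expos_lists] card_length_sum_list[of "Suc N" D]
    binomial_symmetric[of N "D + N"]
  by simp

lemma finite_expos: "finite (expos N D)"
  \<comment> \<open>Infinite sets have cardinality 0, so a positive binomial coefficient forces
    finiteness.\<close>
  using card_expos[of N D] by (intro card_ge_0_finite) (simp add: zero_less_binomial)

lemma expos_add: "\<mu> \<in> expos N D \<Longrightarrow> \<mu>' \<in> expos N D' \<Longrightarrow> \<mu> + \<mu>' \<in> expos N (D + D')"
  by (auto simp: expos_def mon_deg_add keys_add_nat)

definition forms :: "nat \<Rightarrow> nat \<Rightarrow> (nat, 'a::zero) mpoly set" where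
  "forms N D = {p. Poly_Mapping.keys p \<subseteq> expos N D}"

lemma forms_iff: "p \<in> forms N D \<longleftrightarrow> p \<in> polyring N \<and> homogeneous_of_deg D p"
  by (auto simp: forms_def expos_def polyring_def mpoly_vars_def homogeneous_of_deg_def)

lemma forms_zero [simp]: "0 \<in> forms N D"
  by (simp add: forms_def)

lemma forms_add: "p \<in> forms N D \<Longrightarrow> q \<in> forms N D \<Longrightarrow> p + q \<in> forms N D"
  using Poly_Mapping.keys_add[of p q] by (auto simp: forms_def)

lemma forms_sum: "(\<And>i. i \<in> A \<Longrightarrow> f i \<in> forms N D) \<Longrightarrow> sum f A \<in> forms N D"
  by (induction A rule: infinite_finite_induct) (auto intro: forms_add)

lemma forms_mult:
  fixes p q :: "(nat, 'a::comm_ring_1) mpoly"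
  shows "p \<in> forms N D \<Longrightarrow> q \<in> forms N D' \<Longrightarrow> p * q \<in> forms N (D + D')"
  using keys_mult[of p q] by (fastforce simp: forms_def intro: expos_add)

lemma forms_cst: "cst c \<in> forms N 0"
  by (auto simp: forms_def cst_def expos_def)

lemma forms_cst_mult: "p \<in> forms N D \<Longrightarrow> cst c * p \<in> forms N D" for c :: "'a::comm_ring_1"
  using forms_mult[OF forms_cst, of p N D c] by simp

lemma forms_one: "(1 :: (nat, 'a::comm_ring_1) mpoly) \<in> forms N 0"
  using forms_cst[of "1::'a"] by simp

lemma forms_var: "j \<le> N \<Longrightarrow> (var j :: (nat, 'a::comm_ring_1) mpoly) \<in> forms N 1"
  unfolding forms_def var_def expos_def by simp

lemma forms_single: "\<mu> \<in> expos N D \<Longrightarrow> Poly_Mapping.single \<mu> c \<in> forms N D"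
  by (simp add: forms_def)

lemma forms_power: "p \<in> forms N D \<Longrightarrow> p ^ n \<in> forms N (n * D)" for p :: "(nat, 'a::comm_ring_1) mpoly"
  by (induction n) (simp_all add: forms_one forms_mult)

lemma forms_prod:
  fixes f :: "'i \<Rightarrow> (nat, 'a::comm_ring_1) mpoly"
  assumes "\<And>i. i \<in> A \<Longrightarrow> f i \<in> forms N (D i)"
  shows "prod f A \<in> forms N (sum D A)"
  using assms by (induction A rule: infinite_finite_induct) (simp_all add: forms_one forms_mult)

text \<open>Over a ring this is the \<open>m\<close>-th power of the ideal generated by all
  variables, that is, vanishing to order at least \<open>m\<close> at the origin, read off from the
  exponents.\<close>

definition ord_ge :: "nat \<Rightarrow> ('v, 'a::zero) mpoly set" where
  "ord_ge m = {p. \<forall>\<mu>\<in>Poly_Mapping.keys p. m \<le> mon_deg \<mu>}"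

lemma lookup_ord_ge: "p \<in> ord_ge m \<Longrightarrow> mon_deg \<mu> < m \<Longrightarrow> Poly_Mapping.lookup p \<mu> = 0"
  unfolding ord_ge_def using in_keys_iff leD by fast

lemma ord_geI: "(\<And>\<mu>. mon_deg \<mu> < m \<Longrightarrow> Poly_Mapping.lookup p \<mu> = 0) \<Longrightarrow> p \<in> ord_ge m"
  by (force simp: ord_ge_def in_keys_iff)

lemma ord_ge_mono: "p \<in> ord_ge m \<Longrightarrow> m' \<le> m \<Longrightarrow> p \<in> ord_ge m'"
  by (auto simp: ord_ge_def)

lemma ord_ge_zero [simp]: "0 \<in> ord_ge m"
  by (simp add: ord_ge_def)

lemma ord_ge_0 [simp]: "p \<in> ord_ge 0"
  by (simp add: ord_ge_def)

lemma ord_ge_add: "p \<in> ord_ge m \<Longrightarrow> q \<in> ord_ge m \<Longrightarrow> p + q \<in> ord_ge m"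
  using Poly_Mapping.keys_add[of p q] by (auto simp: ord_ge_def)

lemma ord_ge_uminus: "p \<in> ord_ge m \<Longrightarrow> - p \<in> ord_ge m" for p :: "('v, 'a::ab_group_add) mpoly"
  by (simp add: ord_ge_def)

lemma ord_ge_mult:
  fixes p q :: "('v, 'a::comm_ring_1) mpoly"
  shows "p \<in> ord_ge m \<Longrightarrow> q \<in> ord_ge m' \<Longrightarrow> p * q \<in> ord_ge (m + m')"
  using keys_mult[of p q] by (fastforce simp: ord_ge_def mon_deg_add intro: add_mono)

lemma ord_ge_power: "p \<in> ord_ge m \<Longrightarrow> p ^ n \<in> ord_ge (n * m)" for p :: "('v, 'a::comm_ring_1) mpoly"
  by (induction n) (auto intro: ord_ge_mult)

lemma ord_ge_mult_left: "q \<in> ord_ge m \<Longrightarrow> p * q \<in> ord_ge m" for q :: "('v, 'a::comm_ring_1) mpoly"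
  using ord_ge_mult[of p 0 q m] by simp

lemma ord_ge_mult_right: "p \<in> ord_ge m \<Longrightarrow> p * q \<in> ord_ge m" for q :: "('v, 'a::comm_ring_1) mpoly"
  using ord_ge_mult[of p m q 0] by simp

lemma ord_ge_single: "m \<le> mon_deg \<mu> \<Longrightarrow> Poly_Mapping.single \<mu> c \<in> ord_ge m"
  by (simp add: ord_ge_def)

lemma ord_ge_var: "(var j :: ('v, 'a::comm_ring_1) mpoly) \<in> ord_ge 1"
  by (simp add: var_def ord_ge_single)

text \<open>The Taylor expansion at a point of the cone over projective space, in the affine
  directions \<open>1..N\<close> only. The variables of the target are the local coordinates.\<close>

definition shift_var :: "(nat \<Rightarrow> 'a::comm_ring_1) \<Rightarrow> nat \<Rightarrow> (nat, 'a) mpoly" where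
  "shift_var a j = (if j = 0 then cst (a 0) else cst (a j) + var j)"

definition shift :: "(nat \<Rightarrow> 'a::comm_ring_1) \<Rightarrow> (nat, 'a) mpoly \<Rightarrow> (nat, 'a) mpoly" where
  "shift a p = (\<Sum>m\<in>Poly_Mapping.keys p. cst (Poly_Mapping.lookup p m) * mon_val (shift_var a) m)"

interpretation shift: mpoly_hom cst "shift_var a"
  rewrites "mpoly_hom.ext cst (shift_var a) = shift a" for a :: "nat \<Rightarrow> 'a::comm_ring_1"
proof -
  show "mpoly_hom (cst :: 'a \<Rightarrow> (nat, 'a) mpoly)"
    by unfold_locales (auto simp: cst_add cst_mult)
  then show "mpoly_hom.ext cst (shift_var a) = shift a"
    by (simp add: fun_eq_iff mpoly_hom.ext_def shift_def)
qed

lemma shift_cst [simp]: "shift a (cst c) = cst c"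
  using shift.ext_single[of a 0 c] by (simp add: cst_def)

lemma shift_var_eq: "shift a (var j) = shift_var a j"
  by (simp add: var_def shift.ext_single)

text \<open>Modulo terms of positive degree, \<open>shift a\<close> is evaluation at
  \<open>a\<close>: this holds for each variable and passes to products and sums.\<close>

lemma shift_const_coeff: "shift a p - cst (mpoly_eval a p) \<in> ord_ge 1"
proof -
  have pw: "shift_var a j ^ e - cst (a j ^ e) \<in> ord_ge 1" for j e
  proof (induction e)
    case (Suc e)
    have "shift_var a j - cst (a j) \<in> ord_ge 1"
      unfolding shift_var_def using ord_ge_var by (cases "j = 0") (simp_all del: One_nat_def)
    moreover have "shift_var a j ^ Suc e - cst (a j ^ Suc e) =
        shift_var a j * (shift_var a j ^ e - cst (a j ^ e)) + (shift_var a j - cst (a j)) * cst (a j ^ e)"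
      by (simp add: cst_mult algebra_simps)
    ultimately show ?case
      using Suc by (metis ord_ge_add ord_ge_mult_left ord_ge_mult_right)
  qed simp
  have mv: "(\<Prod>i\<in>S. shift_var a i ^ Poly_Mapping.lookup \<mu> i) -
      cst (\<Prod>i\<in>S. a i ^ Poly_Mapping.lookup \<mu> i) \<in> ord_ge 1" for \<mu> :: "nat \<Rightarrow>\<^sub>0 nat" and S
  proof (induction S rule: infinite_finite_induct)
    case (insert j S)
    let ?p = "\<Prod>i\<in>S. shift_var a i ^ Poly_Mapping.lookup \<mu> i"
    let ?q = "\<Prod>i\<in>S. a i ^ Poly_Mapping.lookup \<mu> i"
    let ?e = "Poly_Mapping.lookup \<mu> j"
    have "shift_var a j ^ ?e * ?p - cst (a j ^ ?e * ?q) =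
      shift_var a j ^ ?e * (?p - cst ?q) + (shift_var a j ^ ?e - cst (a j ^ ?e)) * cst ?q"
      by (simp add: cst_mult algebra_simps)
    also have "\<dots> \<in> ord_ge 1"
      by (intro ord_ge_add ord_ge_mult_left ord_ge_mult_right insert.IH pw)
    finally show ?case
      using insert.hyps by simp
  qed simp_all
  show ?thesis
  proof (induction p rule: mpoly_induct)
    case (single \<mu> c)
    have "shift a (Poly_Mapping.single \<mu> c) - cst (mpoly_eval a (Poly_Mapping.single \<mu> c)) =
        cst c * (mon_val (shift_var a) \<mu> - cst (mon_val a \<mu>))"
      by (simp add: shift.ext_single eval.ext_single cst_mult right_diff_distrib)
    then show ?case
      using mv[of \<mu> "Poly_Mapping.keys \<mu>"] by (auto simp: mon_val_def intro!: ord_ge_mult_left)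
  next
    case (add p q)
    have "shift a (p + q) - cst (mpoly_eval a (p + q)) =
        (shift a p - cst (mpoly_eval a p)) + (shift a q - cst (mpoly_eval a q))"
      by (simp add: shift.ext_add eval.ext_add cst_add)
    then show ?case
      using add by (auto intro: ord_ge_add)
  qed
qed

text \<open>The scalar 1 in the definition of \<open>point_ideal\<close> gives vanishing at the
  representative itself, so the constant Taylor coefficient is 0.\<close>

lemma shift_point_ideal: "p \<in> point_ideal N a \<Longrightarrow> shift a p \<in> ord_ge 1"
proof -
  assume "p \<in> point_ideal N a"
  then have "mpoly_eval (\<lambda>j. 1 * a j) p = 0"
    unfolding point_ideal_def by blast
  then show ?thesis
    using shift_const_coeff[of a p] by simp
qed

section \<open>Powers of point ideals\<close>

lemma ideal_gen_subset:
  assumes "0 \<in> T" "\<And>p q. p \<in> T \<Longrightarrow> q \<in> T \<Longrightarrow> p + q \<in> T"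
    and "\<And>c g. c \<in> R \<Longrightarrow> g \<in> S \<Longrightarrow> c * g \<in> T"
  shows "ideal_gen R S \<subseteq> T"
proof -
  have "(\<Sum>i<n. c i * g i) \<in> T" if "\<forall>i<n. c i \<in> R \<and> g i \<in> S" for n :: nat and c g
    using that by (induction n) (auto intro: assms)
  then show ?thesis
    by (auto simp: ideal_gen_def)
qed

lemma mult_mem_ideal_gen:
  assumes "c \<in> R" "g \<in> S"
  shows "c * g \<in> ideal_gen R S"
proof -
  have "c * g = (\<Sum>i<1::nat. (\<lambda>_. c) i * (\<lambda>_. g) i)" by simp
  then show ?thesis
    using assms unfolding ideal_gen_def mem_Collect_eq
    by (intro exI[of _ "1::nat"] exI[of _ "\<lambda>_. c"] exI[of _ "\<lambda>_. g"]) simp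
qed

text \<open>Passes from the algebraic power of the ideal to Taylor coefficients: each of the
  \<open>m\<close> factors has order at least 1, and orders add under products.\<close>

lemma shift_ideal_pow:
  "p \<in> ideal_pow (polyring N) (point_ideal N a) m \<Longrightarrow> shift a p \<in> ord_ge m"
proof (induction m arbitrary: p)
  case (Suc m)
  have "shift a (c * (f * h)) \<in> ord_ge (Suc m)"
    if "f \<in> point_ideal N a" "h \<in> ideal_pow (polyring N) (point_ideal N a) m" for c f h
    using ord_ge_mult[OF shift_point_ideal Suc.IH, of f N a h] that
    by (simp add: shift.ext_mult ord_ge_mult_left)
  then have "ideal_pow (polyring N) (point_ideal N a) (Suc m) \<subseteq> {p. shift a p \<in> ord_ge (Suc m)}"
    unfolding ideal_pow.simps by (intro ideal_gen_subset) (auto simp: shift.ext_add intro: ord_ge_add)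
  then show ?case using Suc.prems by blast
qed simp

lemma polyring_add: "p \<in> polyring N \<Longrightarrow> q \<in> polyring N \<Longrightarrow> p + q \<in> polyring N"
  using Poly_Mapping.keys_add[of p q] by (fastforce simp: polyring_def mpoly_vars_def)

lemma polyring_mult:
  fixes p q :: "(nat, 'a::comm_ring_1) mpoly"
  shows "p \<in> polyring N \<Longrightarrow> q \<in> polyring N \<Longrightarrow> p * q \<in> polyring N"
  using keys_mult[of p q] by (fastforce simp: polyring_def mpoly_vars_def keys_add_nat)

lemma ideal_pow_subset_polyring: "ideal_pow (polyring N) (point_ideal N a) m \<subseteq> polyring N"
proof (induction m)
  case (Suc m)
  have "f \<in> polyring N" if "f \<in> point_ideal N a" for f
    using that by (simp add: point_ideal_def)
  with Suc show ?case
    unfolding ideal_pow.simps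
    by (intro ideal_gen_subset)
      (auto intro!: polyring_add polyring_mult, auto simp: polyring_def mpoly_vars_def)
qed simp

text \<open>Ensures later that symbolic powers contain nonzero forms, so that the
  \<open>LEAST\<close> in \<open>alpha\<close> is attained.\<close>

lemma power_mem_ideal_pow: "p \<in> point_ideal N a \<Longrightarrow> p ^ m \<in> ideal_pow (polyring N) (point_ideal N a) m"
proof (induction m)
  case 0
  then show ?case by (auto simp: polyring_def mpoly_vars_def)
next
  case (Suc m)
  have "1 \<in> polyring N" by (auto simp: polyring_def mpoly_vars_def)
  then have "1 * (p * p ^ m) \<in> ideal_pow (polyring N) (point_ideal N a) (Suc m)"
    unfolding ideal_pow.simps using Suc by (intro mult_mem_ideal_gen) auto
  then show ?case by simp
qed

section \<open>Linear systems with more unknowns than equations\<close>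

lemma underdetermined_system:
  fixes A :: "'i \<Rightarrow> 'j \<Rightarrow> 'k::field"
  assumes "finite I" "finite J" "card J < card I"
  shows "\<exists>x. (\<exists>i\<in>I. x i \<noteq> 0) \<and> (\<forall>j\<in>J. (\<Sum>i\<in>I. x i * A i j) = 0)"
proof -
  define n where "n = card I"
  obtain e where e: "bij_betw e {0..<n} I"
    using ex_bij_betw_nat_finite[OF assms(1)] n_def by blast
  obtain e' where e': "bij_betw e' {0..<card J} J"
    using ex_bij_betw_nat_finite[OF assms(2)] by blast
  \<comment> \<open>Zero rows pad the system to a square matrix, so that a vanishing determinant
    yields a kernel vector.\<close>
  define M where "M = mat n n (\<lambda>(r, c). if r < card J then A (e c) (e' r) else 0)"
  have M: "M \<in> carrier_mat n n" by (simp add: M_def)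
  \<comment> \<open>\<open>card J\<close> is the first padded row, so every product in the Leibniz
    expansion contains an entry of a zero row.\<close>
  have "(\<Prod>i = 0..<n. M $$ (i, p i)) = 0" if "p permutes {0..<n}" for p
  proof (rule prod_zero)
    have "card J < n" "p (card J) < n"
      using assms(3) permutes_in_image[OF that, of "card J"] by (auto simp: n_def)
    then show "\<exists>i\<in>{0..<n}. M $$ (i, p i) = 0"
      by (intro bexI[of _ "card J"]) (auto simp: M_def)
  qed simp
  then have "det M = 0"
    unfolding det_def'[OF M] by (intro sum.neutral) auto
  then obtain v where v: "v \<in> carrier_vec n" "v \<noteq> 0\<^sub>v n" "M *\<^sub>v v = 0\<^sub>v n"
    using det_0_iff_vec_prod_zero_field[OF M] by auto
  define x where "x = (\<lambda>i. v $ (inv_into {0..<n} e i))"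
  have xe: "x (e c) = v $ c" if "c < n" for c
    using that e by (simp add: x_def bij_betw_def)
  obtain c where c: "c < n" "v $ c \<noteq> 0"
    using v(1,2) by (auto simp: vec_eq_iff)
  have "\<exists>i\<in>I. x i \<noteq> 0"
    using c xe e by (intro bexI[of _ "e c"]) (auto simp: bij_betw_def)
  moreover have "(\<Sum>i\<in>I. x i * A i j) = 0" if j: "j \<in> J" for j
  proof -
    obtain r where r: "r < card J" "j = e' r"
      using bij_betw_imp_surj_on[OF e'] j by force
    then have rn: "r < n" using assms(3) n_def by simp
    have "(\<Sum>i\<in>I. x i * A i j) = (\<Sum>c = 0..<n. v $ c * A (e c) j)"
      using sum.reindex_bij_betw[OF e, of "\<lambda>i. x i * A i j"] by (simp add: xe)
    also have "\<dots> = (M *\<^sub>v v) $ r"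
      using r rn v(1) by (auto simp: M_def scalar_prod_def mult.commute intro!: sum.cong)
    finally show ?thesis using v(3) rn by simp
  qed
  ultimately show ?thesis by blast
qed

section \<open>Separation of jets\<close>

text \<open>The Taylor coefficients with these exponents form the jet of order \<open>c\<close> in
  the \<open>N\<close> local coordinates.\<close>

definition loc_expos :: "nat \<Rightarrow> nat \<Rightarrow> (nat \<Rightarrow>\<^sub>0 nat) set" where
  "loc_expos N c = {\<gamma>. Poly_Mapping.keys \<gamma> \<subseteq> {1..N} \<and> mon_deg \<gamma> \<le> c}"

text \<open>Homogenisation: the exponent of variable 0 fills the degree up to \<open>c\<close>, and
  the inverse forgets it.\<close>

lemma bij_betw_loc_expos:
  "bij_betw (\<lambda>\<gamma>. \<gamma> + Poly_Mapping.single 0 (c - mon_deg \<gamma>)) (loc_expos N c) (expos N c)"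
proof (rule bij_betwI[where g = "\<lambda>\<mu>. \<mu> - Poly_Mapping.single 0 (Poly_Mapping.lookup \<mu> 0)"])
  show "(\<lambda>\<gamma>. \<gamma> + Poly_Mapping.single 0 (c - mon_deg \<gamma>)) \<in> loc_expos N c \<rightarrow> expos N c"
    by (fastforce simp: loc_expos_def expos_def mon_deg_add keys_add_nat)
  have split: "\<mu> - Poly_Mapping.single 0 (Poly_Mapping.lookup \<mu> 0) +
      Poly_Mapping.single 0 (Poly_Mapping.lookup \<mu> 0) = \<mu>" for \<mu> :: "nat \<Rightarrow>\<^sub>0 nat"
    by (rule poly_mapping_eqI) (auto simp: lookup_add lookup_minus lookup_single when_def)
  have deg: "mon_deg (\<mu> - Poly_Mapping.single 0 (Poly_Mapping.lookup \<mu> 0)) +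
      Poly_Mapping.lookup \<mu> 0 = mon_deg \<mu>" for \<mu> :: "nat \<Rightarrow>\<^sub>0 nat"
    using arg_cong[OF split[of \<mu>], of mon_deg] by (simp add: mon_deg_add)
  have k: "Poly_Mapping.keys (\<mu> - Poly_Mapping.single 0 (Poly_Mapping.lookup \<mu> 0)) =
      Poly_Mapping.keys \<mu> - {0}" for \<mu> :: "nat \<Rightarrow>\<^sub>0 nat"
    by (auto simp: in_keys_iff lookup_minus lookup_single when_def split: if_splits)
  show "(\<lambda>\<mu>. \<mu> - Poly_Mapping.single 0 (Poly_Mapping.lookup \<mu> 0)) \<in> expos N c \<rightarrow> loc_expos N c"
  proof
    fix \<mu> assume "\<mu> \<in> expos N c"
    then show "\<mu> - Poly_Mapping.single 0 (Poly_Mapping.lookup \<mu> 0) \<in> loc_expos N c"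
      using deg[of \<mu>] by (auto simp: expos_def loc_expos_def k Suc_le_eq)
  qed
  show "\<gamma> + Poly_Mapping.single 0 (c - mon_deg \<gamma>) -
      Poly_Mapping.single 0 (Poly_Mapping.lookup (\<gamma> + Poly_Mapping.single 0 (c - mon_deg \<gamma>)) 0) = \<gamma>"
    if "\<gamma> \<in> loc_expos N c" for \<gamma>
  proof -
    have "Poly_Mapping.lookup \<gamma> 0 = 0"
      using that by (auto simp: loc_expos_def in_keys_iff)
    then show ?thesis by (simp add: lookup_add)
  qed
  show "\<mu> - Poly_Mapping.single 0 (Poly_Mapping.lookup \<mu> 0) +
      Poly_Mapping.single 0 (c - mon_deg (\<mu> - Poly_Mapping.single 0 (Poly_Mapping.lookup \<mu> 0))) = \<mu>"
    if "\<mu> \<in> expos N c" for \<mu>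
  proof -
    have "c - mon_deg (\<mu> - Poly_Mapping.single 0 (Poly_Mapping.lookup \<mu> 0)) = Poly_Mapping.lookup \<mu> 0"
      using deg[of \<mu>] that by (simp add: expos_def)
    then show ?thesis using split[of \<mu>] by simp
  qed
qed

lemma card_loc_expos: "card (loc_expos N c) = (c + N) choose N"
  using bij_betw_same_card[OF bij_betw_loc_expos] card_expos by simp

lemma finite_loc_expos: "finite (loc_expos N c)"
  using bij_betw_finite[OF bij_betw_loc_expos] finite_expos by blast

text \<open>Units of exponent are moved one at a time from \<open>\<beta>'\<close> to
  \<open>\<beta>\<close>.\<close>

lemma loc_expos_split:
  assumes "e \<le> mon_deg \<gamma>"
  obtains \<beta> \<beta>' :: "'v \<Rightarrow>\<^sub>0 nat" where "\<gamma> = \<beta> + \<beta>'" "mon_deg \<beta> = e"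
proof -
  have "\<exists>\<beta> \<beta>'. \<gamma> = \<beta> + \<beta>' \<and> mon_deg \<beta> = e"
    using assms
  proof (induction e)
    case 0
    then show ?case by (intro exI[of _ 0] exI[of _ \<gamma>]) simp
  next
    case (Suc e)
    then obtain \<beta> \<beta>' where b: "\<gamma> = \<beta> + \<beta>'" "mon_deg \<beta> = e" by auto
    then have "\<beta>' \<noteq> 0" using Suc.prems by auto
    then obtain i where i: "Poly_Mapping.lookup \<beta>' i \<noteq> 0"
      by (metis poly_mapping_eqI lookup_zero)
    let ?s = "Poly_Mapping.single i (1::nat)"
    have "\<gamma> = (\<beta> + ?s) + (\<beta>' - ?s)"
      using i by (intro poly_mapping_eqI) (auto simp: b lookup_add lookup_minus lookup_single when_def)
    moreover have "mon_deg (\<beta> + ?s) = Suc e" by (simp add: mon_deg_add b)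
    ultimately show ?case by blast
  qed
  then show ?thesis using that by blast
qed

text \<open>No term order is involved: all terms other than the leading one have strictly larger
  degree. The coefficient \<open>u\<close> may be 0, so its nonvanishing is stated separately where
  it matters.\<close>

definition has_lead :: "('v, 'a::ab_group_add) mpoly \<Rightarrow> ('v \<Rightarrow>\<^sub>0 nat) \<Rightarrow> 'a \<Rightarrow> bool" where
  "has_lead p \<gamma> u \<longleftrightarrow> p - Poly_Mapping.single \<gamma> u \<in> ord_ge (Suc (mon_deg \<gamma>))"

text \<open>With each factor written as leading term plus remainder, every product other than that
  of the leading terms contains a remainder and so gains one order.\<close>

lemma has_lead_mult:
  fixes p q :: "('v, 'a::comm_ring_1) mpoly"
  assumes "has_lead p \<gamma> u" "has_lead q \<delta> v"
  shows "has_lead (p * q) (\<gamma> + \<delta>) (u * v)"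
proof -
  let ?u = "Poly_Mapping.single \<gamma> u" and ?v = "Poly_Mapping.single \<delta> v"
  have U: "p - ?u \<in> ord_ge (Suc (mon_deg \<gamma>))" and V: "q - ?v \<in> ord_ge (Suc (mon_deg \<delta>))"
    using assms by (simp_all add: has_lead_def)
  have "p * q - Poly_Mapping.single (\<gamma> + \<delta>) (u * v) = (p - ?u) * (q - ?v) + (p - ?u) * ?v + ?u * (q - ?v)"
    by (simp add: algebra_simps mult_single)
  also have "\<dots> \<in> ord_ge (Suc (mon_deg (\<gamma> + \<delta>)))"
  proof (intro ord_ge_add)
    show "(p - ?u) * (q - ?v) \<in> ord_ge (Suc (mon_deg (\<gamma> + \<delta>)))"
      using ord_ge_mult[OF U V] by (simp add: mon_deg_add ord_ge_mono)
    show "(p - ?u) * ?v \<in> ord_ge (Suc (mon_deg (\<gamma> + \<delta>)))"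
      using ord_ge_mult[OF U ord_ge_single[of "mon_deg \<delta>" \<delta> v]] by (simp add: mon_deg_add)
    show "?u * (q - ?v) \<in> ord_ge (Suc (mon_deg (\<gamma> + \<delta>)))"
      using ord_ge_mult[OF ord_ge_single[of "mon_deg \<gamma>" \<gamma> u] V] by (simp add: mon_deg_add)
  qed
  finally show ?thesis by (simp add: has_lead_def)
qed

lemma has_lead_one: "has_lead (1 :: ('v, 'a::comm_ring_1) mpoly) 0 1"
  by (simp add: has_lead_def)

lemma has_lead_prod:
  fixes p :: "'i \<Rightarrow> ('v, 'a::comm_ring_1) mpoly"
  assumes "\<And>i. i \<in> A \<Longrightarrow> has_lead (p i) (\<gamma> i) (u i)"
  shows "has_lead (prod p A) (sum \<gamma> A) (prod u A)"
  using assms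
  by (induction A rule: infinite_finite_induct) (simp_all add: has_lead_one has_lead_mult)

lemma has_lead_power_single:
  fixes p :: "('v, 'a::comm_ring_1) mpoly"
  assumes "has_lead p (Poly_Mapping.single j 1) u"
  shows "has_lead (p ^ n) (Poly_Mapping.single j n) (u ^ n)"
proof (induction n)
  case (Suc n)
  from has_lead_mult[OF assms Suc] show ?case by (simp add: single_add[symmetric])
qed (simp add: has_lead_one)

text \<open>A dual basis, up to triangularity, for the jets of order at most \<open>c\<close> at the points
  \<open>P 0, \<dots>, P (n - 1)\<close>: its existence says that forms of degree \<open>D\<close> separate these jets.\<close>

definition jet_triangular ::
    "nat \<Rightarrow> nat \<Rightarrow> (nat \<Rightarrow> nat \<Rightarrow> 'k::field) \<Rightarrow> nat \<Rightarrow> nat \<Rightarrow> (nat \<Rightarrow> (nat \<Rightarrow>\<^sub>0 nat) \<Rightarrow> (nat, 'k) mpoly) \<Rightarrow> bool" where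
  "jet_triangular N n P c D G \<longleftrightarrow> (\<forall>i<n. \<forall>\<gamma>\<in>loc_expos N c. G i \<gamma> \<in> forms N D \<and>
     (\<exists>u. u \<noteq> 0 \<and> has_lead (shift (P i) (G i \<gamma>)) \<gamma> u) \<and>
     (\<forall>i'<n. i' \<noteq> i \<longrightarrow> shift (P i') (G i \<gamma>) \<in> ord_ge (Suc (mon_deg \<gamma>))))"

text \<open>By induction on the degree of \<open>\<gamma>\<close>, the coefficient at
  \<open>\<gamma>\<close> of the expansion at point \<open>i\<close> isolates
  \<open>x i \<gamma>\<close>.\<close>

lemma jet_triangular_indep:
  assumes G: "jet_triangular N n P c D G"
    and S: "\<And>i. i < n \<Longrightarrow>
      shift (P i) (\<Sum>(i, \<gamma>)\<in>{..<n} \<times> loc_expos N c. cst (x i \<gamma>) * G i \<gamma>) \<in> ord_ge (Suc c)"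
  shows "i < n \<Longrightarrow> \<gamma> \<in> loc_expos N c \<Longrightarrow> x i \<gamma> = 0"
proof (induction "mon_deg \<gamma>" arbitrary: i \<gamma> rule: less_induct)
  case less
  obtain u where u: "u \<noteq> 0" "shift (P i) (G i \<gamma>) - Poly_Mapping.single \<gamma> u \<in> ord_ge (Suc (mon_deg \<gamma>))"
    using G less.prems unfolding jet_triangular_def has_lead_def by blast
  let ?t = "\<lambda>i' \<gamma>'. x i' \<gamma>' * Poly_Mapping.lookup (shift (P i) (G i' \<gamma>')) \<gamma>"
  \<comment> \<open>If \<open>\<gamma>'\<close> has smaller degree, its coefficient is 0 by
    induction. Otherwise the expansion at a different point starts beyond the degree of
    \<open>\<gamma>\<close>, and at the same point it contributes only through its leading
    term.\<close>
  have t: "?t i' \<gamma>' = (if i' = i \<and> \<gamma>' = \<gamma> then x i \<gamma> * u else 0)"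
    if i': "i' < n" and \<gamma>': "\<gamma>' \<in> loc_expos N c" for i' \<gamma>'
  proof (cases "mon_deg \<gamma>' < mon_deg \<gamma>")
    case True
    then show ?thesis using less.hyps i' \<gamma>' by auto
  next
    case False
    show ?thesis
    proof (cases "i' = i")
      case True
      obtain v where v: "shift (P i) (G i \<gamma>') - Poly_Mapping.single \<gamma>' v \<in> ord_ge (Suc (mon_deg \<gamma>'))"
        using G less.prems i' \<gamma>' unfolding jet_triangular_def has_lead_def by blast
      show ?thesis
        using True False lookup_ord_ge[OF v, of \<gamma>] lookup_ord_ge[OF u(2), of \<gamma>]
        by (auto simp: lookup_minus lookup_single when_def)
    next
      case neq: False
      then have "shift (P i) (G i' \<gamma>') \<in> ord_ge (Suc (mon_deg \<gamma>'))"
        using G less.prems i' \<gamma>' unfolding jet_triangular_def by blast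
      from lookup_ord_ge[OF this, of \<gamma>] show ?thesis
        using neq False by simp
    qed
  qed
  have "0 = Poly_Mapping.lookup (shift (P i) (\<Sum>(i, \<gamma>)\<in>{..<n} \<times> loc_expos N c. cst (x i \<gamma>) * G i \<gamma>)) \<gamma>"
    using lookup_ord_ge[OF S[OF less.prems(1)], of \<gamma>] less.prems(2) by (simp add: loc_expos_def)
  also have "\<dots> = (\<Sum>(i', \<gamma>')\<in>{..<n} \<times> loc_expos N c. ?t i' \<gamma>')"
    by (simp add: shift.ext_sum lookup_sum case_prod_unfold shift.ext_mult lookup_cst_mult)
  also have "\<dots> = (\<Sum>z\<in>{..<n} \<times> loc_expos N c. if z = (i, \<gamma>) then x i \<gamma> * u else 0)"
  proof (rule sum.cong[OF refl])
    fix z assume "z \<in> {..<n} \<times> loc_expos N c"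
    then show "(case z of (i', \<gamma>') \<Rightarrow> ?t i' \<gamma>') = (if z = (i, \<gamma>) then x i \<gamma> * u else 0)"
      using t[of "fst z" "snd z"] by (cases z) (simp only: prod.inject lessThan_iff mem_Sigma_iff fst_conv snd_conv prod.case)
  qed
  also have "\<dots> = x i \<gamma> * u"
    using less.prems finite_loc_expos by simp
  finally show ?case using u by simp
qed

text \<open>Products of the given forms work: leading terms multiply, and at other points the orders
  add up to one more than required.\<close>

lemma jet_triangular_add:
  assumes G: "jet_triangular N n P c D G" and H: "jet_triangular N n P c' D' H"
  shows "\<exists>K. jet_triangular N n P (c + c') (D + D') K"
proof -
  have "\<forall>\<gamma>\<in>loc_expos N (c + c'). \<exists>b. \<gamma> = fst b + snd b \<and> fst b \<in> loc_expos N c \<and> snd b \<in> loc_expos N c'"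
  proof
    fix \<gamma> assume g: "\<gamma> \<in> loc_expos N (c + c')"
    \<comment> \<open>Taking the first part as large as \<open>c\<close> permits leaves degree at
      most \<open>c'\<close> for the second.\<close>
    obtain \<beta> \<beta>' where b: "\<gamma> = \<beta> + \<beta>'" "mon_deg \<beta> = min c (mon_deg \<gamma>)"
      using loc_expos_split[of "min c (mon_deg \<gamma>)" \<gamma>] by auto
    have "mon_deg \<gamma> = mon_deg \<beta> + mon_deg \<beta>'" unfolding b(1) by (rule mon_deg_add)
    then have "mon_deg \<beta>' \<le> c'"
      using b(2) g unfolding loc_expos_def by (auto simp: min_def split: if_splits)
    then show "\<exists>b. \<gamma> = fst b + snd b \<and> fst b \<in> loc_expos N c \<and> snd b \<in> loc_expos N c'"
      using b g by (intro exI[of _ "(\<beta>, \<beta>')"]) (simp add: loc_expos_def keys_add_nat)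
  qed
  from bchoice[OF this] obtain b where b: "\<And>\<gamma>. \<gamma> \<in> loc_expos N (c + c') \<Longrightarrow>
      \<gamma> = fst (b \<gamma>) + snd (b \<gamma>) \<and> fst (b \<gamma>) \<in> loc_expos N c \<and> snd (b \<gamma>) \<in> loc_expos N c'"
    by blast
  define l r where "l = fst \<circ> b" and "r = snd \<circ> b"
  have lr: "\<gamma> = l \<gamma> + r \<gamma> \<and> l \<gamma> \<in> loc_expos N c \<and> r \<gamma> \<in> loc_expos N c'"
    if "\<gamma> \<in> loc_expos N (c + c')" for \<gamma>
    using b[OF that] by (simp add: l_def r_def)
  have "jet_triangular N n P (c + c') (D + D') (\<lambda>i \<gamma>. G i (l \<gamma>) * H i (r \<gamma>))"
    unfolding jet_triangular_def
  proof (intro allI impI ballI conjI)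
    fix i \<gamma> assume i: "i < n" and g: "\<gamma> \<in> loc_expos N (c + c')"
    note b = lr[OF g]
    have deg: "mon_deg \<gamma> = mon_deg (l \<gamma>) + mon_deg (r \<gamma>)"
      using arg_cong[OF conjunct1[OF b], of mon_deg] by (simp add: mon_deg_add)
    show "G i (l \<gamma>) * H i (r \<gamma>) \<in> forms N (D + D')"
      using G H i b unfolding jet_triangular_def by (blast intro: forms_mult)
    show "shift (P i') (G i (l \<gamma>) * H i (r \<gamma>)) \<in> ord_ge (Suc (mon_deg \<gamma>))" if "i' < n" "i' \<noteq> i" for i'
    proof -
      have "shift (P i') (G i (l \<gamma>)) * shift (P i') (H i (r \<gamma>))
          \<in> ord_ge (Suc (mon_deg (l \<gamma>)) + Suc (mon_deg (r \<gamma>)))"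
        using G H i b that unfolding jet_triangular_def by (blast intro: ord_ge_mult)
      then show ?thesis by (simp add: shift.ext_mult deg ord_ge_mono)
    qed
    obtain u where u: "u \<noteq> 0" and
      U: "has_lead (shift (P i) (G i (l \<gamma>))) (l \<gamma>) u"
      using G i b unfolding jet_triangular_def by blast
    obtain v where v: "v \<noteq> 0" and
      V: "has_lead (shift (P i) (H i (r \<gamma>))) (r \<gamma>) v"
      using H i b unfolding jet_triangular_def by blast
    have "has_lead (shift (P i) (G i (l \<gamma>)) * shift (P i) (H i (r \<gamma>))) (l \<gamma> + r \<gamma>) (u * v)"
      using U V by (rule has_lead_mult)
    then have "has_lead (shift (P i) (G i (l \<gamma>)) * shift (P i) (H i (r \<gamma>))) \<gamma> (u * v)"
      using b by simp
    then show "\<exists>u. u \<noteq> 0 \<and> has_lead (shift (P i) (G i (l \<gamma>) * H i (r \<gamma>))) \<gamma> u"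
      using u v by (intro exI[of _ "u * v"]) (simp add: shift.ext_mult)
  qed
  then show ?thesis by blast
qed

text \<open>The factor is \<open>Suc r\<close> because at factor 0 only constants would be
  available, and these cannot separate several points.\<close>

lemma jet_triangular_scale:
  assumes "jet_triangular N n P c D G"
  shows "\<exists>K. jet_triangular N n P (Suc r * c) (Suc r * D) K"
proof (induction r)
  case 0
  then show ?case using assms by auto
next
  case (Suc r)
  then show ?case using jet_triangular_add[OF assms] by auto
qed

text \<open>Multiples of \<open>F\<close> by forms of degree \<open>D - d\<close> vanish to order
  greater than \<open>c\<close> at all the points, which no nontrivial combination of the forms
  \<open>G i \<gamma>\<close> does. Hence both families together are independent among the forms of
  degree \<open>D\<close>.\<close>

lemma jet_triangular_count:
  assumes G: "jet_triangular N n P c D G"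
    and F: "F \<in> forms N d" "F \<noteq> 0" "\<And>i. i < n \<Longrightarrow> shift (P i) F \<in> ord_ge (Suc c)" and d: "d \<le> D"
  shows "((D - d + N) choose N) + n * ((c + N) choose N) \<le> (D + N) choose N"
proof (rule ccontr)
  assume neg: "\<not> ?thesis"
  define \<Omega> where "\<Omega> = {..<n} \<times> loc_expos N c"
  define V where "V = (\<lambda>z. case z of Inl (i, \<gamma>) \<Rightarrow> G i \<gamma> | Inr \<mu> \<Rightarrow> F * Poly_Mapping.single \<mu> 1)"
  have fin: "finite \<Omega>" "finite (expos N (D - d))"
    by (simp_all add: \<Omega>_def finite_loc_expos finite_expos)
  have "card (\<Omega> <+> expos N (D - d)) = n * ((c + N) choose N) + ((D - d + N) choose N)"
    by (simp add: card_Plus fin card_expos) (simp add: \<Omega>_def card_loc_expos card_cartesian_product)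
  with neg have "card (expos N D) < card (\<Omega> <+> expos N (D - d))"
    by (simp add: card_expos)
  \<comment> \<open>There are more vectors \<open>V z\<close> than monomials, which gives a
    nontrivial relation; below it is split into \<open>S\<close> and \<open>F * Q\<close>.\<close>
  from underdetermined_system[OF _ finite_expos this, of "\<lambda>z. Poly_Mapping.lookup (V z)"]
  obtain x where x: "\<exists>z\<in>\<Omega> <+> expos N (D - d). x z \<noteq> 0"
    and sys: "\<And>\<nu>. \<nu> \<in> expos N D \<Longrightarrow>
      (\<Sum>z\<in>\<Omega> <+> expos N (D - d). x z * Poly_Mapping.lookup (V z) \<nu>) = 0"
    using fin by auto
  define S where "S = (\<Sum>(i, \<gamma>)\<in>\<Omega>. cst (x (Inl (i, \<gamma>))) * G i \<gamma>)"
  define Q where "Q = (\<Sum>\<mu>\<in>expos N (D - d). Poly_Mapping.single \<mu> (x (Inr \<mu>)))"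
  have "V z \<in> forms N D" if "z \<in> \<Omega> <+> expos N (D - d)" for z
    using that G F(1) d forms_mult[OF F(1) forms_single, of _ "D - d"] unfolding jet_triangular_def
    by (auto simp: V_def \<Omega>_def)
  then have "(\<Sum>z\<in>\<Omega> <+> expos N (D - d). cst (x z) * V z) \<in> forms N D"
    by (intro forms_sum forms_cst_mult)
  then have "(\<Sum>z\<in>\<Omega> <+> expos N (D - d). cst (x z) * V z) = 0"
    using sys by (intro poly_mapping_eqI)
      (force simp: forms_def in_keys_iff lookup_sum lookup_cst_mult)
  also have "(\<Sum>z\<in>\<Omega> <+> expos N (D - d). cst (x z) * V z) = S + F * Q"
    unfolding S_def Q_def sum_distrib_left
    by (simp add: sum.Plus fin V_def case_prod_unfold mult.left_commute flip: single_eq_cst_mult)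
  finally have SQ: "S + F * Q = 0" .
  have "shift (P i) S \<in> ord_ge (Suc c)" if "i < n" for i
  proof -
    have "shift (P i) S = - (shift (P i) F * shift (P i) Q)"
      using arg_cong[OF SQ, of "shift (P i)"]
      by (simp add: shift.ext_add shift.ext_mult eq_neg_iff_add_eq_0)
    then show ?thesis using F(3)[OF that] by (simp add: ord_ge_uminus ord_ge_mult_right)
  qed
  then have xl: "x (Inl (i, \<gamma>)) = 0" if "(i, \<gamma>) \<in> \<Omega>" for i \<gamma>
    using jet_triangular_indep[OF G, of "\<lambda>i \<gamma>. x (Inl (i, \<gamma>))"] that
    by (auto simp: S_def \<Omega>_def)
  then have "S = 0"
    unfolding S_def by (intro sum.neutral) auto
  \<comment> \<open>Polynomials over a field have no zero divisors, so \<open>F\<close>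
    cancels.\<close>
  with SQ F(2) have "Q = 0" by simp
  have "x (Inr \<mu>) = 0" if "\<mu> \<in> expos N (D - d)" for \<mu>
  proof -
    have "x (Inr \<mu>) = Poly_Mapping.lookup Q \<mu>"
      using that fin by (simp add: Q_def lookup_sum lookup_single when_def)
    then show ?thesis using \<open>Q = 0\<close> by simp
  qed
  with x xl show False by auto
qed

section \<open>Jets on a grid\<close>

text \<open>Base-\<open>k\<close> digits enumerate the grid by the numbers below
  \<open>k ^ N\<close>. Positions start at 1 to match the affine coordinates
  \<open>1..N\<close>.\<close>

definition digit :: "nat \<Rightarrow> nat \<Rightarrow> nat \<Rightarrow> nat" where
  "digit k i j = i div k ^ (j - 1) mod k"

lemma digit_less: "0 < k \<Longrightarrow> digit k i j < k"
  by (simp add: digit_def)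

text \<open>The base-\<open>k\<close> expansion makes the numbering of grid points injective; later
  it also evaluates the linear form \<open>L\<close> on the grid.\<close>

lemma sum_digits_mod: "(\<Sum>j\<in>{1..N}. k ^ (j - 1) * digit k i j) = i mod k ^ N"
proof (induction N)
  case (Suc N)
  have "(\<Sum>j\<in>{1..Suc N}. k ^ (j - 1) * digit k i j) = i mod k ^ N + k ^ N * (i div k ^ N mod k)"
    using Suc by (simp add: digit_def)
  also have "\<dots> = i mod (k ^ N * k)"
    by (simp add: mod_mult2_eq)
  finally show ?case by (simp add: mult.commute)
qed simp

lemma sum_digits: "i < k ^ N \<Longrightarrow> (\<Sum>j\<in>{1..N}. k ^ (j - 1) * digit k i j) = i"
  using sum_digits_mod[of k i N] by simp

definition grid_plane :: "nat \<Rightarrow> nat \<Rightarrow> (nat, 'a::comm_ring_1) mpoly" where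
  "grid_plane j l = var j + cst (- of_nat l) * var 0"

text \<open>The complete intersection of the forms \<open>\<Prod>l<k. grid_plane j l\<close> is a grid, and monomials in
  these forms times Lagrange polynomials of the grid interpolate jets on it; the power of
  \<open>var 0\<close> homogenises.\<close>

definition grid_form ::
    "nat \<Rightarrow> nat \<Rightarrow> nat \<Rightarrow> (nat \<Rightarrow> nat) \<Rightarrow> (nat \<Rightarrow>\<^sub>0 nat) \<Rightarrow> (nat, 'a::comm_ring_1) mpoly" where
  "grid_form N k c q \<gamma> = var 0 ^ (k * (c - mon_deg \<gamma>)) *
     (\<Prod>j\<in>{1..N}. (\<Prod>l<k. grid_plane j l) ^ Poly_Mapping.lookup \<gamma> j) *
     (\<Prod>j\<in>{1..N}. \<Prod>l\<in>{..<k} - {q j}. grid_plane j l)"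

lemma grid_plane_forms: "j \<le> N \<Longrightarrow> grid_plane j l \<in> forms N 1"
  unfolding grid_plane_def by (intro forms_add forms_cst_mult forms_var) simp_all

lemma mon_deg_loc_expos: "\<gamma> \<in> loc_expos N c \<Longrightarrow> (\<Sum>j\<in>{1..N}. Poly_Mapping.lookup \<gamma> j) = mon_deg \<gamma>"
  by (auto simp: loc_expos_def intro!: mon_deg_superset[symmetric])

text \<open>The degree is made up of \<open>k * (c - mon_deg \<gamma>)\<close> from the power of
  \<open>var 0\<close>, \<open>k * mon_deg \<gamma>\<close> from the generators of the complete
  intersection, and \<open>k - 1\<close> from each of the \<open>N\<close> Lagrange
  products.\<close>

lemma grid_form_forms:
  assumes "\<gamma> \<in> loc_expos N c" "\<And>j. j \<in> {1..N} \<Longrightarrow> q j < k"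
  shows "grid_form N k c q \<gamma> \<in> forms N (k * c + N * (k - 1))"
proof -
  have "grid_form N k c q \<gamma> \<in> forms N (k * (c - mon_deg \<gamma>) * 1 +
      (\<Sum>j\<in>{1..N}. Poly_Mapping.lookup \<gamma> j * (\<Sum>l<k. 1)) + (\<Sum>j\<in>{1..N}. \<Sum>l\<in>{..<k} - {q j}. 1))"
    unfolding grid_form_def
    by (intro forms_mult forms_power forms_prod forms_var grid_plane_forms) auto
  moreover have "(\<Sum>j\<in>{1..N}. \<Sum>l\<in>{..<k} - {q j}. 1) = N * (k - 1)"
    using assms(2) by (simp add: card_Diff_singleton_if)
  moreover have "(\<Sum>j\<in>{1..N}. Poly_Mapping.lookup \<gamma> j * (\<Sum>l<k. 1)) = k * mon_deg \<gamma>"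
    using mon_deg_loc_expos[OF assms(1)] by (simp add: mult.commute flip: sum_distrib_left)
  moreover have "k * (c - mon_deg \<gamma>) + k * mon_deg \<gamma> = k * c"
    using assms(1) by (simp add: loc_expos_def flip: distrib_left)
  ultimately show ?thesis by simp
qed

lemma shift_grid_plane:
  fixes P :: "nat \<Rightarrow> 'a::comm_ring_1"
  assumes "P 0 = 1" "j \<noteq> 0"
  shows "shift P (grid_plane j l) = cst (P j - of_nat l) + var j"
proof -
  have "cst (P j - of_nat l) = (cst (P j) + cst (- of_nat l) :: (nat, 'a) mpoly)"
    by (simp flip: cst_add)
  then show ?thesis
    using assms by (simp add: grid_plane_def shift.ext_add shift.ext_mult shift_var_eq shift_var_def)
qed

lemma has_lead_cst_var: "has_lead (cst u + var j) 0 u" for u :: "'a::comm_ring_1"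
  using ord_ge_var unfolding has_lead_def by (simp add: cst_def)

lemma has_lead_var: "has_lead (var j) (Poly_Mapping.single j 1) (1::'a::comm_ring_1)"
  by (simp add: has_lead_def var_def)

text \<open>At the grid point itself, one factor of each generator becomes the local coordinate, and
  all the remaining planes have nonzero constant terms.\<close>

lemma has_lead_grid_form:
  fixes P :: "nat \<Rightarrow> 'a::field_char_0"
  assumes "\<gamma> \<in> loc_expos N c" "P 0 = 1"
    and q: "\<And>j. j \<in> {1..N} \<Longrightarrow> P j = of_nat (q j)" "\<And>j. j \<in> {1..N} \<Longrightarrow> q j < k"
  shows "\<exists>u. u \<noteq> 0 \<and> has_lead (shift P (grid_form N k c q \<gamma>)) \<gamma> u"
proof -
  \<comment> \<open>The value at \<open>q j\<close> of the Lagrange product of coordinate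
    \<open>j\<close>; it is nonzero because distinct naturals stay distinct in characteristic
    0.\<close>
  define v :: "nat \<Rightarrow> 'a" where "v j = (\<Prod>l\<in>{..<k} - {q j}. of_nat (q j) - of_nat l)" for j
  have v0: "v j \<noteq> 0" for j
    by (auto simp: v_def)
  have lag: "has_lead (shift P (\<Prod>l\<in>{..<k} - {q j}. grid_plane j l)) 0 (v j)" if "j \<in> {1..N}" for j
    using has_lead_prod[of "{..<k} - {q j}" "\<lambda>l. shift P (grid_plane j l)" "\<lambda>_. 0" "\<lambda>l. of_nat (q j) - of_nat l"]
      that assms(2) q by (simp add: shift.ext_prod shift_grid_plane has_lead_cst_var v_def)
  have gen: "has_lead (shift P (\<Prod>l<k. grid_plane j l)) (Poly_Mapping.single j 1) (v j)" if "j \<in> {1..N}" for j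
  proof -
    have "(\<Prod>l<k. grid_plane j l) = grid_plane j (q j) * (\<Prod>l\<in>{..<k} - {q j}. grid_plane j l :: (nat, 'a) mpoly)"
      using q(2)[OF that] by (intro prod.remove) auto
    moreover have "shift P (grid_plane j (q j)) = var j"
      using that assms(2) q by (simp add: shift_grid_plane)
    ultimately show ?thesis
      using has_lead_mult[OF has_lead_var lag[OF that], of j] by (simp add: shift.ext_mult)
  qed
  have "has_lead (\<Prod>j\<in>{1..N}. shift P (\<Prod>l<k. grid_plane j l) ^ Poly_Mapping.lookup \<gamma> j)
      (\<Sum>j\<in>{1..N}. Poly_Mapping.single j (Poly_Mapping.lookup \<gamma> j)) (\<Prod>j\<in>{1..N}. v j ^ Poly_Mapping.lookup \<gamma> j)"
    by (intro has_lead_prod has_lead_power_single gen)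
  moreover have "(\<Sum>j\<in>{1..N}. Poly_Mapping.single j (Poly_Mapping.lookup \<gamma> j)) = \<gamma>"
    using assms(1) by (intro poly_mapping_eqI)
      (auto simp: loc_expos_def lookup_sum lookup_single when_def in_keys_iff)
  moreover have "has_lead (\<Prod>j\<in>{1..N}. shift P (\<Prod>l\<in>{..<k} - {q j}. grid_plane j l))
      (\<Sum>j\<in>{1..N}. 0) (\<Prod>j\<in>{1..N}. v j)"
    by (intro has_lead_prod lag)
  moreover have "shift P (var 0) = 1"
    using assms(2) by (simp add: shift_var_eq shift_var_def)
  ultimately have "has_lead (shift P (grid_form N k c q \<gamma>)) \<gamma>
      ((\<Prod>j\<in>{1..N}. v j ^ Poly_Mapping.lookup \<gamma> j) * (\<Prod>j\<in>{1..N}. v j))"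
    using has_lead_mult by (fastforce simp: grid_form_def shift.ext_mult shift.ext_power shift.ext_prod)
  then show ?thesis
    using v0 by (intro exI conjI) auto
qed

text \<open>At another grid point the generators still contribute order
  \<open>mon_deg \<gamma>\<close>, and in a coordinate \<open>j0\<close> where the two points differ
  the Lagrange product contributes one more.\<close>

lemma grid_form_ord:
  fixes P :: "nat \<Rightarrow> 'a::field_char_0"
  assumes "\<gamma> \<in> loc_expos N c" "P 0 = 1"
    and q': "\<And>j. j \<in> {1..N} \<Longrightarrow> P j = of_nat (q' j)" "\<And>j. j \<in> {1..N} \<Longrightarrow> q' j < k"
    and j0: "j0 \<in> {1..N}" "q j0 \<noteq> q' j0"
  shows "shift P (grid_form N k c q \<gamma>) \<in> ord_ge (Suc (mon_deg \<gamma>))"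
proof -
  have van: "shift P (\<Prod>l\<in>A. grid_plane j l) \<in> ord_ge 1" if "j \<in> {1..N}" "q' j \<in> A" "finite A" for j A
  proof -
    have "shift P (grid_plane j (q' j)) \<in> ord_ge 1"
      using that q' assms(2) by (simp add: shift_grid_plane ord_ge_var del: One_nat_def)
    moreover have "shift P (\<Prod>l\<in>A. grid_plane j l) =
        shift P (grid_plane j (q' j)) * shift P (\<Prod>l\<in>A - {q' j}. grid_plane j l)"
      unfolding prod.remove[OF that(3,2), of "\<lambda>l. grid_plane j l"] by (rule shift.ext_mult)
    ultimately show ?thesis by (simp add: ord_ge_mult_right del: One_nat_def)
  qed
  have "(\<Prod>j\<in>B. shift P (\<Prod>l<k. grid_plane j l) ^ Poly_Mapping.lookup \<gamma> j)
      \<in> ord_ge (\<Sum>j\<in>B. Poly_Mapping.lookup \<gamma> j)" if "B \<subseteq> {1..N}" for B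
    using finite_subset[OF that] that
  proof (induction B rule: infinite_finite_induct)
    case (insert j B)
    have "shift P (\<Prod>l<k. grid_plane j l) ^ Poly_Mapping.lookup \<gamma> j \<in> ord_ge (Poly_Mapping.lookup \<gamma> j * 1)"
      using insert.prems q'(2)[of j] by (intro ord_ge_power van) auto
    then show ?case
      using insert by (auto intro: ord_ge_mult)
  qed auto
  from this[OF order_refl] have 1: "(\<Prod>j\<in>{1..N}. shift P (\<Prod>l<k. grid_plane j l) ^ Poly_Mapping.lookup \<gamma> j)
      \<in> ord_ge (mon_deg \<gamma>)"
    by (simp add: mon_deg_loc_expos[OF assms(1)] del: One_nat_def)
  have "(\<Prod>j\<in>{1..N}. shift P (\<Prod>l\<in>{..<k} - {q j}. grid_plane j l)) \<in> ord_ge 1"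
    using van[OF j0(1), of "{..<k} - {q j0}"] q'(2)[OF j0(1)] j0
    by (subst prod.remove[of _ j0]) (auto intro: ord_ge_mult_right)
  from ord_ge_mult[OF 1 this] show ?thesis
    by (simp add: grid_form_def shift.ext_mult shift.ext_power shift.ext_prod mult.assoc ord_ge_mult_left)
qed

lemma jet_triangular_grid:
  fixes P :: "nat \<Rightarrow> nat \<Rightarrow> 'a::field_char_0"
  assumes "0 < k" "\<And>i. i < k ^ N \<Longrightarrow> P i 0 = 1"
    and "\<And>i j. i < k ^ N \<Longrightarrow> j \<in> {1..N} \<Longrightarrow> P i j = of_nat (digit k i j)"
  shows "jet_triangular N (k ^ N) P c (k * c + N * (k - 1)) (\<lambda>i. grid_form N k c (digit k i))"
  unfolding jet_triangular_def
proof (intro allI impI ballI conjI)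
  fix i \<gamma> assume i: "i < k ^ N" and g: "\<gamma> \<in> loc_expos N c"
  show "grid_form N k c (digit k i) \<gamma> \<in> forms N (k * c + N * (k - 1))"
    using g assms(1) by (intro grid_form_forms digit_less)
  show "\<exists>u. u \<noteq> 0 \<and> has_lead (shift (P i) (grid_form N k c (digit k i) \<gamma>)) \<gamma> u"
    using assms i g by (intro has_lead_grid_form) (auto simp: digit_less)
  show "shift (P i') (grid_form N k c (digit k i) \<gamma>) \<in> ord_ge (Suc (mon_deg \<gamma>))"
    if i': "i' < k ^ N" "i' \<noteq> i" for i'
  proof -
    obtain j0 where "j0 \<in> {1..N}" "digit k i j0 \<noteq> digit k i' j0"
    proof (rule ccontr)
      assume "\<not> thesis"
      then have "\<And>j. j \<in> {1..N} \<Longrightarrow> digit k i j = digit k i' j" using that by blast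
      then have "i = i'"
        using sum_digits[OF i] sum_digits[OF i'(1)] by simp
      with i' show False by simp
    qed
    then show ?thesis
      using assms i' g by (intro grid_form_ord[of _ _ _ _ "digit k i'"]) (auto simp: digit_less)
  qed
qed

section \<open>Openness\<close>

lemma mpoly_vars_add: "mpoly_vars (p + q) \<subseteq> mpoly_vars p \<union> mpoly_vars q"
  using Poly_Mapping.keys_add[of p q] by (auto simp: mpoly_vars_def)

lemma mpoly_vars_mult: "mpoly_vars (p * q) \<subseteq> mpoly_vars p \<union> mpoly_vars q"
  for p q :: "('v, 'a::comm_ring_1) mpoly"
  using keys_mult[of p q] by (fastforce simp: mpoly_vars_def keys_add_nat)

text \<open>\<open>shift\<close> replaces variable 0 by a constant, so the exponents in
  \<open>loc_expos N c\<close> account for all Taylor coefficients of degree at most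
  \<open>c\<close>.\<close>

lemma mpoly_vars_shift:
  fixes p :: "(nat, 'a::comm_ring_1) mpoly"
  assumes "p \<in> forms N D"
  shows "mpoly_vars (shift P p) \<subseteq> {1..N}"
proof -
  let ?L = "{q :: (nat, 'a) mpoly. mpoly_vars q \<subseteq> {1..N}}"
  have cst: "cst u \<in> ?L" for u
    by (auto simp: mpoly_vars_def cst_def)
  have add: "q + r \<in> ?L" if "q \<in> ?L" "r \<in> ?L" for q r
    using mpoly_vars_add[of q r] that by blast
  have mult: "q * r \<in> ?L" if "q \<in> ?L" "r \<in> ?L" for q r
    using mpoly_vars_mult[of q r] that by blast
  have var: "shift_var P j \<in> ?L" if "j \<le> N" for j
  proof (cases "j = 0")
    case True
    then show ?thesis using cst by (simp add: shift_var_def)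
  next
    case False
    then have "var j \<in> ?L" using that by (auto simp: mpoly_vars_def var_def)
    then show ?thesis using False add[OF cst] by (simp add: shift_var_def)
  qed
  have pow: "q ^ e \<in> ?L" if "q \<in> ?L" for q e
    using that by (induction e) (use cst[of 1] in simp, simp only: power_Suc mult)
  have prod: "(\<Prod>j\<in>J. f j) \<in> ?L" if "\<And>j. j \<in> J \<Longrightarrow> f j \<in> ?L" for J :: "nat set" and f
    using that
  proof (induction J rule: infinite_finite_induct)
    case (insert j J)
    show ?case
      unfolding prod.insert[OF insert.hyps] by (intro mult insert.IH insert.prems) auto
  qed (use cst[of 1] in simp_all)
  have sum: "(\<Sum>m\<in>S. f m) \<in> ?L" if "\<And>m. m \<in> S \<Longrightarrow> f m \<in> ?L" for S :: "(nat \<Rightarrow>\<^sub>0 nat) set" and f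
    using that
  proof (induction S rule: infinite_finite_induct)
    case (insert j J)
    show ?case
      unfolding sum.insert[OF insert.hyps] by (intro add insert.IH insert.prems) auto
  qed (use cst[of 0] in simp_all)
  have "shift P p \<in> ?L"
    unfolding shift_def mon_val_def
  proof (intro sum mult cst prod pow var)
    fix m j assume "m \<in> Poly_Mapping.keys p" "j \<in> Poly_Mapping.keys m"
    then show "j \<le> N" using assms by (force simp: forms_def expos_def)
  qed
  then show ?thesis by simp
qed

section \<open>Polynomial functions of the coordinates of the points\<close>

definition poly_fun :: "'v set \<Rightarrow> (('v \<Rightarrow> 'a::comm_ring_1) \<Rightarrow> 'a) set" where
  "poly_fun V = {\<phi>. \<exists>F. mpoly_vars F \<subseteq> V \<and> \<phi> = (\<lambda>a. mpoly_eval a F)}"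

lemma poly_funI: "mpoly_vars F \<subseteq> V \<Longrightarrow> (\<And>a. \<phi> a = mpoly_eval a F) \<Longrightarrow> \<phi> \<in> poly_fun V"
  by (auto simp: poly_fun_def)

lemma poly_fun_mono: "\<phi> \<in> poly_fun V \<Longrightarrow> V \<subseteq> V' \<Longrightarrow> \<phi> \<in> poly_fun V'"
  by (auto simp: poly_fun_def)

lemma zariski_open_poly_fun: "\<phi> \<in> poly_fun V \<Longrightarrow> zariski_open V {a. \<phi> a \<noteq> 0}"
  unfolding poly_fun_def zariski_open_def by clarify (rule exI[of _ "{_}"], auto)

lemma poly_fun_const: "(\<lambda>a. c) \<in> poly_fun V"
  by (rule poly_funI[of "cst c"]) (auto simp: mpoly_vars_def cst_def eval.ext_single)

lemma poly_fun_coord: "v \<in> V \<Longrightarrow> (\<lambda>a. a v) \<in> poly_fun V"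
  by (rule poly_funI[of "var v"]) (auto simp: mpoly_vars_def var_def eval.ext_single)

lemma poly_fun_add:
  assumes "\<phi> \<in> poly_fun V" "\<psi> \<in> poly_fun V"
  shows "(\<lambda>a. \<phi> a + \<psi> a) \<in> poly_fun V"
proof -
  obtain F G where "mpoly_vars F \<subseteq> V" "mpoly_vars G \<subseteq> V" "\<phi> = (\<lambda>a. mpoly_eval a F)" "\<psi> = (\<lambda>a. mpoly_eval a G)"
    using assms by (auto simp: poly_fun_def)
  then show ?thesis
    using mpoly_vars_add[of F G] by (intro poly_funI[of "F + G"]) (auto simp: eval.ext_add)
qed

lemma poly_fun_mult:
  assumes "\<phi> \<in> poly_fun V" "\<psi> \<in> poly_fun V"
  shows "(\<lambda>a. \<phi> a * \<psi> a) \<in> poly_fun V"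
proof -
  obtain F G where "mpoly_vars F \<subseteq> V" "mpoly_vars G \<subseteq> V" "\<phi> = (\<lambda>a. mpoly_eval a F)" "\<psi> = (\<lambda>a. mpoly_eval a G)"
    using assms by (auto simp: poly_fun_def)
  then show ?thesis
    using mpoly_vars_mult[of F G] by (intro poly_funI[of "F * G"]) (auto simp: eval.ext_mult)
qed

lemma poly_fun_diff: "\<phi> \<in> poly_fun V \<Longrightarrow> \<psi> \<in> poly_fun V \<Longrightarrow> (\<lambda>a. \<phi> a - \<psi> a) \<in> poly_fun V"
  using poly_fun_add[OF _ poly_fun_mult[OF poly_fun_const[of "-1"]], of \<phi> V \<psi>] by simp

lemma poly_fun_sum: "(\<And>i. i \<in> A \<Longrightarrow> \<phi> i \<in> poly_fun V) \<Longrightarrow> (\<lambda>a. \<Sum>i\<in>A. \<phi> i a) \<in> poly_fun V"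
  by (induction A rule: infinite_finite_induct) (simp_all add: poly_fun_const poly_fun_add)

lemma poly_fun_prod: "(\<And>i. i \<in> A \<Longrightarrow> \<phi> i \<in> poly_fun V) \<Longrightarrow> (\<lambda>a. \<Prod>i\<in>A. \<phi> i a) \<in> poly_fun V"
  by (induction A rule: infinite_finite_induct) (simp_all add: poly_fun_const poly_fun_mult)

text \<open>Multiplication by a variable only shifts exponents. As \<open>shift_var\<close> is a
  constant plus at most one variable, this replaces a convolution formula for coefficients.\<close>

lemma lookup_mult_var:
  "Poly_Mapping.lookup (p * var j) \<beta> =
     (if Poly_Mapping.lookup \<beta> j = 0 then 0 else Poly_Mapping.lookup p (\<beta> - Poly_Mapping.single j 1))"
  for p :: "('v, 'a::comm_ring_1) mpoly"
proof (induction p rule: mpoly_induct)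
  case (single m c)
  have "m + Poly_Mapping.single j 1 = \<beta> \<longleftrightarrow>
      Poly_Mapping.lookup \<beta> j \<noteq> 0 \<and> m = \<beta> - Poly_Mapping.single j 1"
  proof
    assume "Poly_Mapping.lookup \<beta> j \<noteq> 0 \<and> m = \<beta> - Poly_Mapping.single j 1"
    then show "m + Poly_Mapping.single j 1 = \<beta>"
      by (auto simp: lookup_add lookup_minus lookup_single when_def intro!: poly_mapping_eqI)
  qed (auto simp: lookup_add)
  then show ?case
    by (auto simp: var_def mult_single lookup_single when_def)
qed (simp add: distrib_right lookup_add)

definition coeffs_poly_fun :: "'w set \<Rightarrow> (('w \<Rightarrow> 'a::comm_ring_1) \<Rightarrow> ('v, 'a) mpoly) set" where
  "coeffs_poly_fun V = {\<Phi>. \<forall>\<beta>. (\<lambda>a. Poly_Mapping.lookup (\<Phi> a) \<beta>) \<in> poly_fun V}"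

lemma coeffs_poly_fun_cst: "(\<lambda>a. cst c) \<in> coeffs_poly_fun V"
  by (simp add: coeffs_poly_fun_def poly_fun_const)

lemma coeffs_poly_fun_sum:
  "(\<And>i. i \<in> A \<Longrightarrow> \<Phi> i \<in> coeffs_poly_fun V) \<Longrightarrow> (\<lambda>a. \<Sum>i\<in>A. \<Phi> i a) \<in> coeffs_poly_fun V"
  by (simp add: coeffs_poly_fun_def lookup_sum poly_fun_sum)

lemma coeffs_poly_fun_shift_var:
  assumes \<Phi>: "\<Phi> \<in> coeffs_poly_fun V" and V: "(i, 0) \<in> V" "(i, j) \<in> V"
  shows "(\<lambda>a. \<Phi> a * shift_var (\<lambda>j. a (i, j)) j) \<in> coeffs_poly_fun V"
proof -
  have c: "(\<lambda>a. Poly_Mapping.lookup (\<Phi> a * cst (a (i, j'))) \<beta>) \<in> poly_fun V" if "(i, j') \<in> V" for \<beta> j'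
    using \<Phi> that unfolding coeffs_poly_fun_def
    by (subst mult.commute) (simp add: lookup_cst_mult poly_fun_mult poly_fun_coord)
  have "(\<lambda>a. Poly_Mapping.lookup (\<Phi> a * var j) \<beta>) \<in> poly_fun V" for \<beta>
    using \<Phi> by (cases "Poly_Mapping.lookup \<beta> j = 0")
      (simp_all add: lookup_mult_var coeffs_poly_fun_def poly_fun_const)
  then show ?thesis
    using c V by (cases "j = 0")
      (auto simp: shift_var_def coeffs_poly_fun_def distrib_left lookup_add intro: poly_fun_add)
qed

text \<open>The accumulator \<open>\<Phi>\<close> allows the monomial to be built up one factor
  \<open>shift_var\<close> at a time.\<close>

lemma coeffs_poly_fun_mon_val:
  assumes \<Phi>: "\<Phi> \<in> coeffs_poly_fun V" and V: "(i, 0) \<in> V" "\<And>j. j \<in> Poly_Mapping.keys \<mu> \<Longrightarrow> (i, j) \<in> V"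
  shows "(\<lambda>a. \<Phi> a * mon_val (shift_var (\<lambda>j. a (i, j))) \<mu>) \<in> coeffs_poly_fun V"
proof -
  have pw: "(\<lambda>a. \<Psi> a * shift_var (\<lambda>j. a (i, j)) j ^ e) \<in> coeffs_poly_fun V"
    if "\<Psi> \<in> coeffs_poly_fun V" "(i, j) \<in> V" for \<Psi> j e
  proof (induction e)
    case (Suc e)
    from coeffs_poly_fun_shift_var[OF Suc V(1) that(2)] show ?case
      by (simp add: mult_ac)
  qed (use that in simp)
  have "(\<lambda>a. \<Phi> a * (\<Prod>j\<in>J. shift_var (\<lambda>j. a (i, j)) j ^ Poly_Mapping.lookup \<mu> j)) \<in> coeffs_poly_fun V"
    if "finite J" "J \<subseteq> Poly_Mapping.keys \<mu>" for J
    using that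
  proof (induction J)
    case (insert j J)
    from pw[OF insert.IH, of j] show ?case
      using insert V(2) by (simp add: mult_ac)
  qed (use \<Phi> in simp)
  then show ?thesis by (simp add: mon_val_def)
qed

lemma coeffs_poly_fun_shift:
  assumes "h \<in> forms N D" "{i} \<times> {0..N} \<subseteq> V"
  shows "(\<lambda>a. shift (\<lambda>j. a (i, j)) h) \<in> coeffs_poly_fun V"
  unfolding shift_def
proof (intro coeffs_poly_fun_sum coeffs_poly_fun_mon_val coeffs_poly_fun_cst)
  fix m j assume "m \<in> Poly_Mapping.keys h" "j \<in> Poly_Mapping.keys m"
  then have "j \<le> N" using assms(1) by (force simp: forms_def expos_def)
  then show "(i, j) \<in> V" using assms(2) by auto
qed (use assms(2) in auto)

text \<open>The Taylor coefficients of the fixed forms \<open>H i \<gamma>\<close> at varying points constitute a square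
  matrix, whose determinant serves as \<open>\<phi>\<close>.\<close>

lemma jet_triangular_open:
  fixes a0 :: "nat \<times> nat \<Rightarrow> 'k::field"
  assumes H: "jet_triangular N n (\<lambda>i j. a0 (i, j)) c D H"
  shows "\<exists>\<phi>\<in>poly_fun ({..<n} \<times> {0..N}). \<phi> a0 \<noteq> 0 \<and>
    (\<forall>a. \<phi> a \<noteq> 0 \<longrightarrow> (\<exists>G. jet_triangular N n (\<lambda>i j. a (i, j)) c D G))"
proof -
  define \<Omega> where "\<Omega> = {..<n} \<times> loc_expos N c"
  have fin: "finite \<Omega>" by (simp add: \<Omega>_def finite_loc_expos)
  define d where "d = card \<Omega>"
  obtain e where e: "bij_betw e {0..<d} \<Omega>"
    using ex_bij_betw_nat_finite[OF fin] d_def by blast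
  have e\<Omega>: "e r \<in> \<Omega>" if "r < d" for r
    using bij_betw_apply[OF e] that by simp
  define h where "h s = H (fst (e s)) (snd (e s))" for s
  have hf: "h s \<in> forms N D" if "s < d" for s
    using H e\<Omega>[OF that] unfolding jet_triangular_def h_def \<Omega>_def by auto
  define C where "C a r s = Poly_Mapping.lookup (shift (\<lambda>j. a (fst (e r), j)) (h s)) (snd (e r))" for a r s
  define M where "M a = mat d d (\<lambda>(r, s). C a r s)" for a
  have M: "M a \<in> carrier_mat d d" for a by (simp add: M_def)
  define \<phi> where "\<phi> a = det (M a)" for a
  have C: "(\<lambda>a. C a r s) \<in> poly_fun ({..<n} \<times> {0..N})" if "r < d" "s < d" for r s
  proof -
    have "(\<lambda>a. shift (\<lambda>j. a (fst (e r), j)) (h s)) \<in> coeffs_poly_fun ({..<n} \<times> {0..N})"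
      using e\<Omega>[OF that(1)] by (intro coeffs_poly_fun_shift[OF hf[OF that(2)]]) (auto simp: \<Omega>_def)
    then show ?thesis by (simp add: coeffs_poly_fun_def C_def)
  qed
  \<comment> \<open>The Leibniz expansion exhibits the determinant as a polynomial in the
    coordinates.\<close>
  have "\<phi> = (\<lambda>a. \<Sum>p\<in>{p. p permutes {0..<d}}. signof p * (\<Prod>i = 0..<d. C a i (p i)))"
  proof
    fix a
    have "(\<Prod>i = 0..<d. M a $$ (i, p i)) = (\<Prod>i = 0..<d. C a i (p i))" if "p permutes {0..<d}" for p
      using permutes_in_image[OF that] by (intro prod.cong) (auto simp: M_def)
    then show "\<phi> a = (\<Sum>p\<in>{p. p permutes {0..<d}}. signof p * (\<Prod>i = 0..<d. C a i (p i)))"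
      unfolding \<phi>_def det_def'[OF M] by simp
  qed
  also have "\<dots> \<in> poly_fun ({..<n} \<times> {0..N})"
  proof (intro poly_fun_sum poly_fun_mult poly_fun_const poly_fun_prod)
    fix p i assume "p \<in> {p. p permutes {0..<d}}" "i \<in> {0..<d}"
    then show "(\<lambda>a. C a i (p i)) \<in> poly_fun ({..<n} \<times> {0..N})"
      using permutes_in_image[of p "{0..<d}" i] by (intro C) auto
  qed
  finally have \<phi>: "\<phi> \<in> poly_fun ({..<n} \<times> {0..N})" .
  have shift_comb: "Poly_Mapping.lookup (shift (\<lambda>j. a (fst (e r), j)) (\<Sum>s = 0..<d. cst (v s) * h s)) (snd (e r)) =
      (\<Sum>s = 0..<d. C a r s * v s)" for a v r
    by (simp add: C_def shift.ext_sum shift.ext_mult lookup_sum lookup_cst_mult mult.commute)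
  have index: "\<exists>r<d. e r = (i, \<beta>)" if "i < n" "\<beta> \<in> loc_expos N c" for i \<beta>
  proof -
    have "(i, \<beta>) \<in> e ` {0..<d}"
      using bij_betw_imp_surj_on[OF e] that by (simp add: \<Omega>_def)
    then show ?thesis by force
  qed
  have low: "Poly_Mapping.keys \<beta> \<subseteq> {1..N}"
    if "\<beta> \<in> Poly_Mapping.keys (shift (P :: nat \<Rightarrow> 'k) p)" "p \<in> forms N D" for \<beta> P p
    using mpoly_vars_shift[OF that(2), of P] that(1) by (auto simp: mpoly_vars_def)
  \<comment> \<open>A kernel vector at \<open>a0\<close> would combine the forms into one whose jets
    of order \<open>c\<close> all vanish, against their independence.\<close>
  have "\<phi> a0 \<noteq> 0"
  proof
    assume "\<phi> a0 = 0"
    then obtain v where v: "v \<in> carrier_vec d" "v \<noteq> 0\<^sub>v d" "M a0 *\<^sub>v v = 0\<^sub>v d"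
      using det_0_iff_vec_prod_zero_field[OF M] unfolding \<phi>_def by blast
    define x where "x i \<gamma> = v $ inv_into {0..<d} e (i, \<gamma>)" for i \<gamma>
    have xe: "x (fst (e s)) (snd (e s)) = v $ s" if "s < d" for s
      using bij_betw_inv_into_left[OF e, of s] that by (simp add: x_def)
    have comb: "(\<Sum>(i, \<gamma>)\<in>\<Omega>. cst (x i \<gamma>) * H i \<gamma>) = (\<Sum>s = 0..<d. cst (v $ s) * h s)"
      unfolding sum.reindex_bij_betw[OF e, symmetric]
      by (intro sum.cong) (simp_all add: case_prod_unfold xe h_def)
    have "x i \<gamma> = 0" if "i < n" "\<gamma> \<in> loc_expos N c" for i \<gamma>
    proof (rule jet_triangular_indep[OF H _ that])
      fix i assume i: "i < n"
      let ?S = "\<Sum>s = 0..<d. cst (v $ s) * h s"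
      have S: "?S \<in> forms N D"
        by (intro forms_sum forms_cst_mult hf) simp
      have "shift (\<lambda>j. a0 (i, j)) ?S \<in> ord_ge (Suc c)"
      proof (rule ord_geI)
        fix \<beta> :: "nat \<Rightarrow>\<^sub>0 nat" assume deg: "mon_deg \<beta> < Suc c"
        show "Poly_Mapping.lookup (shift (\<lambda>j. a0 (i, j)) ?S) \<beta> = 0"
        proof (cases "\<beta> \<in> loc_expos N c")
          case True
          then obtain r where r: "r < d" "e r = (i, \<beta>)"
            using index[OF i] by blast
          have "(\<Sum>s = 0..<d. C a0 r s * v $ s) = (M a0 *\<^sub>v v) $ r"
            using r v(1) by (auto simp: M_def scalar_prod_def intro!: sum.cong)
          then show ?thesis
            using shift_comb[where a = a0 and v = "\<lambda>s. v $ s" and r = r] r v(3) by simp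
        next
          case False
          \<comment> \<open>Such an exponent involves variable 0 or one beyond \<open>N\<close>, and
            neither occurs in the expansion of a form.\<close>
          then have "\<not> Poly_Mapping.keys \<beta> \<subseteq> {1..N}"
            using deg by (simp add: loc_expos_def)
          then show ?thesis
            using low[OF _ S, of \<beta> "\<lambda>j. a0 (i, j)"] by (auto simp: in_keys_iff)
        qed
      qed
      then show "shift (\<lambda>j. a0 (i, j)) (\<Sum>(i, \<gamma>)\<in>{..<n} \<times> loc_expos N c. cst (x i \<gamma>) * H i \<gamma>) \<in> ord_ge (Suc c)"
        using comb by (simp add: \<Omega>_def)
    qed
    then have "v $ s = 0" if "s < d" for s
      using xe[OF that] e\<Omega>[OF that] by (auto simp: \<Omega>_def)
    then have "v = 0\<^sub>v d" using v(1) by (intro eq_vecI) auto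
    with v(2) show False by simp
  qed
  moreover have "\<exists>G. jet_triangular N n (\<lambda>i j. a (i, j)) c D G" if a: "\<phi> a \<noteq> 0" for a
  proof -
    obtain B where B: "B \<in> carrier_mat d d" "M a * B = 1\<^sub>m d"
      using det_non_zero_imp_unit[OF M, of a] a unfolding \<phi>_def Units_def ring_mat_def by auto
    \<comment> \<open>Column \<open>l\<close> of the inverse matrix yields the form dual to the
      Taylor coefficient \<open>e l\<close>. The resulting family is diagonal, hence
      triangular.\<close>
    define K where "K l = (\<Sum>s = 0..<d. cst (B $$ (s, l)) * h s)" for l
    have Kf: "K l \<in> forms N D" for l
      unfolding K_def by (intro forms_sum forms_cst_mult hf) simp
    have delta: "Poly_Mapping.lookup (shift (\<lambda>j. a (i, j)) (K l)) \<beta> = (if e l = (i, \<beta>) then 1 else 0)"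
      if "i < n" "mon_deg \<beta> \<le> c" "l < d" for i \<beta> l
    proof (cases "\<beta> \<in> loc_expos N c")
      case True
      from index[OF that(1) this] obtain r where r: "r < d" "e r = (i, \<beta>)"
        by blast
      have "Poly_Mapping.lookup (shift (\<lambda>j. a (i, j)) (K l)) \<beta> = (\<Sum>s = 0..<d. C a r s * B $$ (s, l))"
        using shift_comb[where a = a and v = "\<lambda>s. B $$ (s, l)" and r = r] r by (simp add: K_def)
      also have "\<dots> = (M a * B) $$ (r, l)"
        using r that B(1) by (auto simp: M_def scalar_prod_def intro!: sum.cong)
      also have "\<dots> = (if r = l then 1 else 0)"
        using r that by (simp add: B)
      also have "r = l \<longleftrightarrow> e l = (i, \<beta>)"
        using bij_betw_imp_inj_on[OF e] r that by (auto simp: inj_on_def)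
      finally show ?thesis .
    next
      case False
      then have *: "\<not> Poly_Mapping.keys \<beta> \<subseteq> {1..N}"
        using that by (simp add: loc_expos_def)
      then have "e l \<noteq> (i, \<beta>)"
        using e\<Omega>[OF that(3)] by (auto simp: \<Omega>_def loc_expos_def)
      then show ?thesis
        using low[OF _ Kf, of \<beta> "\<lambda>j. a (i, j)" l] * by (auto simp: in_keys_iff)
    qed
    define G where "G i \<gamma> = K (inv_into {0..<d} e (i, \<gamma>))" for i \<gamma>
    have "jet_triangular N n (\<lambda>i j. a (i, j)) c D G"
      unfolding jet_triangular_def
    proof (intro allI impI ballI conjI)
      fix i \<gamma> assume i: "i < n" and g: "\<gamma> \<in> loc_expos N c"
      obtain l where l: "l < d" "e l = (i, \<gamma>)"
        using index[OF i g] by blast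
      have G: "G i \<gamma> = K l"
        using bij_betw_inv_into_left[OF e, of l] l by (simp add: G_def)
      have c: "mon_deg \<gamma> \<le> c" using g by (simp add: loc_expos_def)
      show "G i \<gamma> \<in> forms N D" by (simp add: G Kf)
      show "\<exists>u. u \<noteq> 0 \<and> has_lead (shift (\<lambda>j. a (i, j)) (G i \<gamma>)) \<gamma> u"
      proof (intro exI[of _ 1] conjI)
        show "has_lead (shift (\<lambda>j. a (i, j)) (G i \<gamma>)) \<gamma> 1"
          unfolding has_lead_def
          using c l i by (intro ord_geI) (auto simp: lookup_minus G delta lookup_single when_def)
      qed simp
      show "shift (\<lambda>j. a (i', j)) (G i \<gamma>) \<in> ord_ge (Suc (mon_deg \<gamma>))" if "i' < n" "i' \<noteq> i" for i'
        using c l that by (intro ord_geI) (auto simp: G delta)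
    qed
    then show ?thesis by blast
  qed
  ultimately show ?thesis using \<phi> by blast
qed

section \<open>The degree bound\<close>

text \<open>The right-hand side is the product of \<open>D + 1, ..., D + N\<close>, each factor
  being at least \<open>D\<close>.\<close>

lemma power_le_binomial_fact: "D ^ N \<le> ((D + N) choose N) * fact N"
proof (induction N)
  case (Suc N)
  have "D ^ Suc N \<le> Suc (D + N) * (((D + N) choose N) * fact N)"
    unfolding power_Suc using Suc by (intro mult_mono) auto
  also have "\<dots> = Suc N * (Suc (D + N) choose Suc N) * fact N"
    unfolding Suc_times_binomial by (simp only: mult.assoc)
  also have "\<dots> = ((D + Suc N) choose Suc N) * fact (Suc N)"
    by (simp only: fact_Suc of_nat_id add_Suc_right mult_ac)
  finally show ?case .
qed simp

text \<open>Guarantees a form of degree \<open>N * (k - 1)\<close> through fewer than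
  \<open>(k + 1) ^ N\<close> points. Dimensions 2 and 3 are computed, and the induction passes from
  \<open>N - 2\<close> to \<open>N\<close> by keeping one term of the Vandermonde identity. The
  bound 4 comes from \<open>N = 2\<close>, where \<open>k = 3\<close> fails with 16 against
  15.\<close>

lemma power_le_binomial_multiple:
  fixes k N :: nat
  assumes k: "4 \<le> k" and "2 \<le> N"
  shows "(k + 1) ^ N \<le> (N * k) choose N"
  using assms(2)
proof (induction N rule: less_induct)
  case (less N)
  \<comment> \<open>In terms of \<open>l\<close>, the polynomial inequalities for dimensions 2 and 3
    hold coefficient by coefficient.\<close>
  obtain l where l: "k = l + 4" using k le_Suc_ex by (metis add.commute)
  have two: "(k + 1)\<^sup>2 \<le> (2 * k) choose 2"
    by (simp add: l choose_two power2_eq_square algebra_simps)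
  consider "N = 2" | "N = 3" | "4 \<le> N" using less.prems by linarith
  then show ?case
  proof cases
    case 1
    with two show ?thesis by simp
  next
    case 2
    have y: "2 * ((3 * l + 11) choose 2) = (3 * l + 11) * (3 * l + 10)"
      using Suc_times_binomial[of 1 "3 * l + 10"]
      by (simp add: numeral_2_eq_2 add.commute del: binomial_Suc_Suc)
    have x: "3 * ((3 * l + 12) choose 3) = (3 * l + 12) * ((3 * l + 11) choose 2)"
    proof -
      have "Suc (3 * l + 11) = 3 * l + 12" "Suc 2 = 3" by simp_all
      with Suc_times_binomial[of 2 "3 * l + 11"] show ?thesis by (simp only:)
    qed
    have "6 * ((3 * l + 12) choose 3) = 2 * (3 * ((3 * l + 12) choose 3))" by linarith
    also have "\<dots> = (3 * l + 12) * ((3 * l + 11) * (3 * l + 10))"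
      unfolding x y[symmetric] by (rule mult.left_commute)
    finally have "6 * ((3 * l + 12) choose 3) = (3 * l + 12) * ((3 * l + 11) * (3 * l + 10))" .
    moreover have "6 * (l + 5) ^ 3 \<le> (3 * l + 12) * ((3 * l + 11) * (3 * l + 10))"
      by (simp add: power3_eq_cube algebra_simps)
    ultimately have "6 * (l + 5) ^ 3 \<le> 6 * ((3 * l + 12) choose 3)" by (simp only:)
    then have "(l + 5) ^ 3 \<le> (3 * l + 12) choose 3" by (rule mult_le_cancel1[THEN iffD1, THEN mp]) simp
    then show ?thesis using 2 by (simp add: l algebra_simps del: binomial_Suc_Suc)
  next
    case 3
    define M where "M = N - 2"
    have M: "N = M + 2" "2 \<le> M" using 3 by (simp_all add: M_def)
    have "(k + 1) ^ N = (k + 1) ^ M * (k + 1)\<^sup>2" by (simp only: M power_add)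
    also have "\<dots> \<le> ((M * k) choose M) * ((2 * k) choose 2)"
      using less.IH[of M] M two by (intro mult_mono) auto
    also have "\<dots> \<le> (\<Sum>i\<le>N. ((M * k) choose i) * ((2 * k) choose (N - i)))"
      using member_le_sum[of M "{..N}" "\<lambda>i. ((M * k) choose i) * ((2 * k) choose (N - i))"] M by simp
    also have "\<dots> = (N * k) choose N"
      by (simp only: M(1) add_mult_distrib vandermonde)
    finally show ?thesis .
  qed
qed

text \<open>Both sides are divided by \<open>r ^ N\<close> before \<open>r\<close> tends to
  infinity, so the shifts \<open>d\<close> and \<open>e\<close> disappear.\<close>

lemma power_ineq_limit:
  fixes A B C d e :: real
  assumes "\<And>r. r0 \<le> r \<Longrightarrow> (real r * A - d) ^ N + (real r * B) ^ N \<le> (real r * C + e) ^ N"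
  shows "A ^ N + B ^ N \<le> C ^ N"
proof (rule LIMSEQ_le)
  have 0: "(\<lambda>r. u / real r) \<longlonglongrightarrow> 0" for u
    by (rule lim_const_over_n)
  have "(\<lambda>r. (A - d / real r) ^ N + B ^ N) \<longlonglongrightarrow> (A - 0) ^ N + B ^ N"
    by (intro tendsto_intros 0)
  then show "(\<lambda>r. (A - d / real r) ^ N + B ^ N) \<longlonglongrightarrow> A ^ N + B ^ N" by simp
  have "(\<lambda>r. (C + e / real r) ^ N) \<longlonglongrightarrow> (C + 0) ^ N"
    by (intro tendsto_intros 0)
  then show "(\<lambda>r. (C + e / real r) ^ N) \<longlonglongrightarrow> C ^ N" by simp
  show "\<exists>M. \<forall>r\<ge>M. (A - d / real r) ^ N + B ^ N \<le> (C + e / real r) ^ N"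
  proof (intro exI allI impI)
    fix r assume r: "max 1 r0 \<le> r"
    then have E: "real r * A - d = real r * (A - d / real r)" "real r * C + e = real r * (C + e / real r)"
      by (simp_all add: field_simps)
    have "real r ^ N * ((A - d / real r) ^ N + B ^ N) \<le> real r ^ N * (C + e / real r) ^ N"
      using assms[of r] r unfolding E distrib_left[of "real r ^ N"] power_mult_distrib[symmetric] by simp
    then show "(A - d / real r) ^ N + B ^ N \<le> (C + e / real r) ^ N"
      using r by simp
  qed
qed

text \<open>Supplies the single jet order \<open>c\<close>, since \<open>K / c\<close> tends to
  0.\<close>

lemma ex_order_gap:
  fixes k K \<epsilon> :: real
  assumes "0 < \<epsilon>"
  shows "\<exists>c::nat. 1 \<le> c \<and> (k + K / real c) ^ N < \<epsilon> + k ^ N"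
proof -
  have "(\<lambda>c. (k + K / real c) ^ N) \<longlonglongrightarrow> (k + 0) ^ N"
    by (intro tendsto_intros lim_const_over_n)
  then have "eventually (\<lambda>c. (k + K / real c) ^ N < \<epsilon> + k ^ N) sequentially"
    using assms by (intro order_tendstoD) auto
  then have "eventually (\<lambda>c. 1 \<le> c \<and> (k + K / real c) ^ N < \<epsilon> + k ^ N) sequentially"
    using eventually_ge_at_top[of 1] by eventually_elim simp
  then show ?thesis
    using eventually_happens by fastforce
qed

text \<open>If the degree were smaller, then for large \<open>r\<close> the multiples of a power of \<open>f\<close> and the
  forms separating jets of order \<open>m * r * c\<close> would be too many independent forms.\<close>

lemma jet_triangular_degree_bound:
  assumes G: "jet_triangular N (k ^ N) P c (k * c + K) G"
    and c: "1 \<le> c" "(real k + real K / real c) ^ N < (1 / real N) ^ N + real k ^ N"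
    and f: "f \<in> forms N d" "f \<noteq> 0" "\<And>i. i < k ^ N \<Longrightarrow> shift (P i) f \<in> ord_ge m"
    and m: "1 \<le> m" and N: "1 \<le> N"
  shows "(real k - 1 / real N) * real m \<le> real d"
proof (rule ccontr)
  assume "\<not> ?thesis"
  then have neg: "real d < (real k - 1 / real N) * real m" by simp
  define t where "t = k * c + K"
  \<comment> \<open>Up to the constant \<open>d\<close>, the number \<open>r * A\<close> is the
    degree of the cofactors that multiply the power of \<open>f\<close> in degree
    \<open>m * r * t\<close>.\<close>
  define A where "A = real m * real t - real c * real d"
  have "real c * (real m / real N) < real c * (real k * real m - real d)"
    using neg c(1) by (intro mult_strict_left_mono) (auto simp: algebra_simps)
  also have "\<dots> \<le> A"
    by (simp add: A_def t_def algebra_simps)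
  finally have A: "real c * (real m / real N) < A" .
  then have "0 < A"
    by (rule le_less_trans[rotated]) simp
  then have "c * d < m * t"
    unfolding A_def by (simp flip: of_nat_mult)
  have step: "(real r * A - real d) ^ N + (real r * (real k * (real m * real c))) ^ N
      \<le> (real r * (real m * real t) + real N) ^ N" if r: "max 1 d \<le> r" for r
  proof -
    obtain R where R: "m * r = Suc R"
      using m r by (metis One_nat_def Suc_pred max.bounded_iff mult_pos_pos not_less_eq_eq le_numeral_extra(3) neq0_conv)
    obtain K' where K': "jet_triangular N (k ^ N) P (m * r * c) (m * r * t) K'"
      using jet_triangular_scale[OF G, of R] unfolding R t_def by blast
    \<comment> \<open>Exponent \<open>c * r\<close> guarantees only order \<open>m * r * c\<close>;
      the extra factor \<open>f\<close> makes the order exceed it, as \<open>m\<close> is at least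
      1.\<close>
    let ?e = "c * r + 1"
    have "r * (c * d) + r \<le> r * (m * t)"
      using \<open>c * d < m * t\<close> mult_le_mono2[of "Suc (c * d)" "m * t" r] by simp
    \<comment> \<open>Since \<open>m * t\<close> exceeds \<open>c * d\<close> by at least 1, there
      is room \<open>r\<close> for the extra \<open>d\<close>.\<close>
    then have le: "?e * d \<le> m * r * t"
      using r by (simp add: algebra_simps)
    have "shift (P i) (f ^ ?e) \<in> ord_ge (Suc (m * r * c))" if "i < k ^ N" for i
      unfolding shift.ext_power
      by (rule ord_ge_mono[OF ord_ge_power[OF f(3)[OF that]]]) (use m in \<open>simp add: algebra_simps\<close>)
    then have "((m * r * t - ?e * d + N) choose N) + k ^ N * ((m * r * c + N) choose N) \<le> (m * r * t + N) choose N"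
      using jet_triangular_count[OF K' forms_power[OF f(1), of ?e] _ _ le] f(2) by simp
    \<comment> \<open>After multiplication by \<open>fact N\<close>, the binomial coefficients on
      the left are bounded below by powers and the one on the right above, at the cost of
      \<open>N\<close> in the base.\<close>
    then have "(((m * r * t - ?e * d + N) choose N) + k ^ N * ((m * r * c + N) choose N)) * fact N
        \<le> ((m * r * t + N) choose N) * fact N"
      by (rule mult_le_mono1)
    also have "\<dots> \<le> (m * r * t + N) ^ N"
      by (rule binomial_fact_pow)
    finally have "(m * r * t - ?e * d) ^ N + k ^ N * (m * r * c) ^ N \<le> (m * r * t + N) ^ N"
      using power_le_binomial_fact[of "m * r * t - ?e * d" N]
        mult_le_mono2[OF power_le_binomial_fact[of "m * r * c" N], of "k ^ N"]
      unfolding distrib_right mult.assoc[of "k ^ N"] by linarith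
    then have "real ((m * r * t - ?e * d) ^ N + k ^ N * (m * r * c) ^ N) \<le> real ((m * r * t + N) ^ N)"
      by (rule of_nat_mono)
    moreover have "real (m * r * t - ?e * d) = real r * A - real d"
      using le by (simp add: of_nat_diff A_def algebra_simps)
    ultimately show ?thesis
      by (simp add: power_mult_distrib mult_ac)
  qed
  have lim: "A ^ N + (real k * (real m * real c)) ^ N \<le> (real m * real t) ^ N"
    using step by (rule power_ineq_limit)
  have mc: "0 < real m * real c" using m c(1) by simp
  \<comment> \<open>As \<open>A\<close> exceeds \<open>c * m / N\<close>, dividing the limit
    inequality by \<open>(m * c) ^ N\<close> contradicts the choice of \<open>c\<close>.\<close>
  have "(real m * real c) ^ N * ((1 / real N) ^ N + real k ^ N) =
      (real c * (real m / real N)) ^ N + (real k * (real m * real c)) ^ N"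
    by (simp add: power_mult_distrib power_divide algebra_simps)
  also have "\<dots> \<le> A ^ N + (real k * (real m * real c)) ^ N"
    using A by (intro add_right_mono power_mono) auto
  also have "\<dots> \<le> (real m * real t) ^ N" by (rule lim)
  also have "real m * real t = (real m * real c) * (real k + real K / real c)"
    using c(1) by (simp add: t_def field_simps)
  finally have "(1 / real N) ^ N + real k ^ N \<le> (real k + real K / real c) ^ N"
    using mc by (simp only: power_mult_distrib[of "real m * real c"] mult_le_cancel_left_pos zero_less_power)
  with c(2) show False by simp
qed

text \<open>Vanishing at \<open>s\<close> representatives imposes \<open>s\<close> linear conditions
  on the coefficients; by homogeneity the form then vanishes on the whole lines through
  them.\<close>

lemma ex_form_through_points:
  fixes P :: "nat \<Rightarrow> nat \<Rightarrow> 'k::field"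
  assumes "s < (e + N) choose N"
  shows "\<exists>g\<in>points_ideal N s P. g \<noteq> 0 \<and> g \<in> forms N e"
proof -
  obtain x where x: "\<exists>\<mu>\<in>expos N e. x \<mu> \<noteq> 0"
    and sys: "\<And>i. i < s \<Longrightarrow> (\<Sum>\<mu>\<in>expos N e. x \<mu> * mon_val (P i) \<mu>) = 0"
    using underdetermined_system[of "expos N e" "{..<s}" "\<lambda>\<mu> i. mon_val (P i) \<mu>"] assms
    by (auto simp: finite_expos card_expos)
  define g where "g = (\<Sum>\<mu>\<in>expos N e. Poly_Mapping.single \<mu> (x \<mu>))"
  have lk: "Poly_Mapping.lookup g \<mu> = x \<mu>" if "\<mu> \<in> expos N e" for \<mu>
    using that by (simp add: g_def lookup_sum lookup_single when_def finite_expos)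
  have g: "g \<in> forms N e"
    unfolding g_def by (intro forms_sum forms_single)
  have "mpoly_eval (\<lambda>j. c * P i j) g = 0" if "i < s" for c i
  proof -
    have "mpoly_eval (\<lambda>j. c * P i j) g = (\<Sum>\<mu>\<in>expos N e. c ^ e * (x \<mu> * mon_val (P i) \<mu>))"
      unfolding g_def eval.ext_sum eval.ext_single
      by (intro sum.cong) (auto simp: mon_val_scale expos_def mult_ac)
    then show ?thesis
      using sys[OF that] by (simp flip: sum_distrib_left)
  qed
  moreover have "g \<noteq> 0" using x lk by auto
  ultimately show ?thesis
    using g by (intro bexI[of _ g]) (auto simp: points_ideal_def point_ideal_def forms_iff)
qed

theorem theorem5p1:
  fixes N s :: nat
  assumes "N \<ge> 2" and "s \<ge> 4 ^ N"
  shows "\<exists>U :: (nat \<times> nat \<Rightarrow> 'k::field_char_0) set.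
           zariski_open ({..<s} \<times> {0..N}) U \<and> U \<noteq> {} \<and>
           (\<forall>a \<in> U. valid_points N s a \<and>
              (\<forall>m::nat. m \<ge> 1 \<longrightarrow>
                 real (alpha (symbolic_power N s (\<lambda>i j. a (i, j)) m)) / real m \<ge>
                 (real (alpha (points_ideal N s (\<lambda>i j. a (i, j)))) + real N - 1) / real N))"
proof -
  \<comment> \<open>The integer part of the \<open>N\<close>-th root of \<open>s\<close>.\<close>
  define k where "k = (LEAST j. s < (j + 1) ^ N)"
  have "s < (s + 1) ^ N"
    using self_le_power[of "s + 1" N] assms(1) by simp
  then have ks: "s < (k + 1) ^ N"
    unfolding k_def by (rule LeastI)
  have k4: "4 \<le> k"
  proof (rule ccontr)
    assume "\<not> 4 \<le> k"
    then have "(k + 1) ^ N \<le> 4 ^ N" by (intro power_mono) auto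
    with ks assms(2) show False by simp
  qed
  have sk: "k ^ N \<le> s"
    using not_less_Least[of "k - 1" "\<lambda>j. s < (j + 1) ^ N", folded k_def] k4 by simp
  \<comment> \<open>The same \<open>K\<close> is the degree of a form through all the points and the
    excess over \<open>k * c\<close> in the degree of the grid forms.\<close>
  define K where "K = N * (k - 1)"
  have "s < (N * k) choose N"
    using ks power_le_binomial_multiple[OF k4 assms(1)] by linarith
  also have "N * k = K + N"
    using k4 by (simp add: K_def algebra_simps diff_mult_distrib2)
  finally have sK: "s < (K + N) choose N" .
  obtain c where c: "1 \<le> c" "(real k + real K / real c) ^ N < (1 / real N) ^ N + real k ^ N"
    using ex_order_gap[of "(1 / real N) ^ N" "real k" "real K" N] assms(1) by auto

  \<comment> \<open>A linear form in the affine coordinates, chosen by base-\<open>k\<close>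
    expansion so that its value on row \<open>i\<close> of \<open>a0\<close> is
    \<open>i\<close>.\<close>
  define L where "L a i = (\<Sum>j\<in>{1..N}. of_nat (k ^ (j - 1)) * a (i, j))" for a :: "nat \<times> nat \<Rightarrow> 'k" and i
  \<comment> \<open>The first \<open>k ^ N\<close> rows are the grid. The others lie on the first
    affine axis at \<open>i\<close>, beyond the grid, so that \<open>L\<close> still returns
    \<open>i\<close>.\<close>
  define a0 :: "nat \<times> nat \<Rightarrow> 'k" where
    "a0 = (\<lambda>(i, j). if j = 0 then 1 else if i < k ^ N then of_nat (digit k i j)
       else if j = 1 then of_nat i else 0)"
  have L0: "L a0 i = of_nat i" for i
  proof (cases "i < k ^ N")
    case True
    then have "L a0 i = of_nat (\<Sum>j\<in>{1..N}. k ^ (j - 1) * digit k i j)"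
      unfolding L_def of_nat_sum by (intro sum.cong) (auto simp: a0_def)
    then show ?thesis using sum_digits[OF True] by (simp only:)
  next
    case False
    have "L a0 i = (\<Sum>j\<in>{1..N}. if j = 1 then of_nat i else 0)"
      unfolding L_def using False by (intro sum.cong) (auto simp: a0_def)
    then show ?thesis using assms(1) by simp
  qed

  have "jet_triangular N (k ^ N) (\<lambda>i j. a0 (i, j)) c (k * c + N * (k - 1)) (\<lambda>i. grid_form N k c (digit k i))"
    using k4 by (intro jet_triangular_grid) (auto simp: a0_def)
  then obtain \<phi> where \<phi>: "\<phi> \<in> poly_fun ({..<k ^ N} \<times> {0..N})" "\<phi> a0 \<noteq> 0"
    and jets: "\<And>a. \<phi> a \<noteq> 0 \<Longrightarrow> \<exists>G. jet_triangular N (k ^ N) (\<lambda>i j. a (i, j)) c (k * c + K) G"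
    using jet_triangular_open unfolding K_def by blast
  \<comment> \<open>A product of two-by-two minors in the coordinate 0 and \<open>L\<close>; if it
    is nonzero, no row is a multiple of another.\<close>
  define sep where "sep a = (\<Prod>(i, i')\<in>{z \<in> {..<s} \<times> {..<s}. fst z \<noteq> snd z}.
      a (i', 0) * L a i - a (i, 0) * L a i')" for a
  define U where "U = {a. \<phi> a * sep a \<noteq> 0}"
  have "sep \<in> poly_fun ({..<s} \<times> {0..N})"
    unfolding sep_def L_def case_prod_unfold
    by (intro poly_fun_prod poly_fun_diff poly_fun_mult poly_fun_sum poly_fun_coord poly_fun_const) auto
  then have "(\<lambda>a. \<phi> a * sep a) \<in> poly_fun ({..<s} \<times> {0..N})"
    using sk by (intro poly_fun_mult poly_fun_mono[OF \<phi>(1)]) auto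
  then have "zariski_open ({..<s} \<times> {0..N}) U"
    unfolding U_def by (rule zariski_open_poly_fun)
  moreover have a00: "a0 (i, 0) = 1" for i by (simp add: a0_def)
  have "sep a0 \<noteq> 0"
    by (auto simp: sep_def L0 a00)
  then have "a0 \<in> U" using \<phi>(2) by (simp add: U_def)
  then have "U \<noteq> {}" by blast
  moreover have "valid_points N s a" if "a \<in> U" for a
  proof -
    have "sep a \<noteq> 0" using that by (simp add: U_def)
    then have neq: "a (i', 0) * L a i \<noteq> a (i, 0) * L a i'" if "i < s" "i' < s" "i \<noteq> i'" for i i'
      using that by (auto simp: sep_def)
    have not_multiple: False if "i < s" "i' < s" "i \<noteq> i'" "\<And>j. j \<le> N \<Longrightarrow> a (i, j) = b * a (i', j)" for i i' b
    proof -
      have "L a i = b * L a i'"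
        unfolding L_def sum_distrib_left using that(4) by (intro sum.cong) (auto simp: mult_ac)
      then show False using neq[OF that(1-3)] that(4)[of 0] by simp
    qed
    have "1 < s"
      using assms(2) one_less_power[of "4::nat" N] assms(1) by linarith
    \<comment> \<open>A zero row would be 0 times another row, and \<open>1 < s\<close> provides
      another one.\<close>
    have "\<exists>j\<le>N. a (i, j) \<noteq> 0" if "i < s" for i
    proof (rule ccontr)
      assume "\<not> (\<exists>j\<le>N. a (i, j) \<noteq> 0)"
      then show False
        using not_multiple[of i 0 0] not_multiple[of i 1 0] that \<open>1 < s\<close> by (cases "i = 0") auto
    qed
    with not_multiple show ?thesis
      unfolding valid_points_def by blast
  qed
  moreover have "(real (alpha (points_ideal N s (\<lambda>i j. a (i, j)))) + real N - 1) / real N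
      \<le> real (alpha (symbolic_power N s (\<lambda>i j. a (i, j)) m)) / real m" if a: "a \<in> U" and m: "1 \<le> m" for a m
  proof -
    let ?P = "\<lambda>i j. a (i, j)"
    let ?d = "alpha (symbolic_power N s ?P m)"
    obtain g where g: "g \<in> points_ideal N s ?P" "g \<noteq> 0" "g \<in> forms N K"
      using ex_form_through_points[OF sK, of ?P] by blast
    then have alpha_le: "alpha (points_ideal N s ?P) \<le> K"
      unfolding alpha_def by (intro Least_le) (auto simp: forms_iff)
    \<comment> \<open>\<open>alpha\<close> is a \<open>LEAST\<close>, which is meaningful only if
      some nonzero form exists; \<open>g ^ m\<close> is one.\<close>
    have "g ^ m \<in> symbolic_power N s ?P m"
      using g(1) by (auto simp: symbolic_power_def points_ideal_def intro: power_mem_ideal_pow)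
    moreover have "g ^ m \<noteq> 0" "homogeneous_of_deg (m * K) (g ^ m)"
      using g forms_power[OF g(3), of m] by (simp_all add: forms_iff)
    ultimately have "\<exists>D. \<exists>f\<in>symbolic_power N s ?P m. f \<noteq> 0 \<and> homogeneous_of_deg D f"
      by blast
    then have "\<exists>f\<in>symbolic_power N s ?P m. f \<noteq> 0 \<and> homogeneous_of_deg ?d f"
      unfolding alpha_def by (rule LeastI_ex)
    then obtain f where f: "f \<in> symbolic_power N s ?P m" "f \<noteq> 0" "homogeneous_of_deg ?d f" by blast
    have fi: "f \<in> ideal_pow (polyring N) (point_ideal N (?P i)) m" if "i < k ^ N" for i
      using f(1) that sk by (auto simp: symbolic_power_def)
    have "f \<in> polyring N"
      using fi[of 0] ideal_pow_subset_polyring k4 by fastforce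
    then have "f \<in> forms N ?d" using f(3) by (simp add: forms_iff)
    moreover have "\<phi> a \<noteq> 0" using a by (simp add: U_def)
    from jets[OF this] obtain G where "jet_triangular N (k ^ N) ?P c (k * c + K) G" by blast
    ultimately have "(real k - 1 / real N) * real m \<le> real ?d"
      using c f(2) m assms(1) shift_ideal_pow[OF fi]
      by (intro jet_triangular_degree_bound[where f = f and P = ?P]) auto
    then have "real k - 1 / real N \<le> real ?d / real m"
      using m by (simp add: field_simps)
    moreover have "(real (alpha (points_ideal N s ?P)) + real N - 1) / real N \<le> (real K + real N - 1) / real N"
      using alpha_le by (intro divide_right_mono) auto
    \<comment> \<open>\<open>K + N - 1\<close> equals \<open>N * k - 1\<close>, so the degree bound
      \<open>k - 1 / N\<close> is exactly the required one with \<open>alpha\<close> of the ideal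
      replaced by its upper bound \<open>K\<close>.\<close>
    moreover have "(real K + real N - 1) / real N = real k - 1 / real N"
      using k4 assms(1) by (simp add: K_def field_simps)
    ultimately show ?thesis by linarith
  qed
  ultimately show ?thesis by blast
qed

end
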